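(* For every integer $n \geq 9$, $$\chi\left(\mathrm{KG}(n,3)_{3\text{-stable}}\right) = n-6.$$
   Context: Write $[n]=\{1,\dots,n\}$. For $i,j\in[n]$ with $i\le j$ let $d(i,j)=d(j,i)=\min\{j-i,\ n+i-j\}$ (the distance in the cycle $C_n$ on $[n]$ in its natural order). A $k$-element subset $A\subseteq[n]$ is $s$-stable if $d(i,j)\ge s$ for all distinct $i,j\in A$. The graph $\mathrm{KG}(n,k)_{s\text{-stable}}$ has as vertices all $s$-stable $k$-element subsets of $[n]$, two of them being adjacent if and only if they are disjoint. $\chi$ denotes the chromatic number. *)

theory Defs
  imports "Graph_Theory.Pair_Digraph"
begin

text \<open>
  A finite simple graph is a \<open>pair_graph\<close>: a finite, loop-free \<open>pair_pre_digraph\<close> with a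
  symmetric arc set, each undirected edge being represented by its two orientations.
\<close>

definition proper_coloring :: "'a pair_pre_digraph \<Rightarrow> nat \<Rightarrow> ('a \<Rightarrow> nat) \<Rightarrow> bool" where
  "proper_coloring G c f \<longleftrightarrow>
     f ` pverts G \<subseteq> {..<c} \<and> (\<forall>(u, v) \<in> parcs G. f u \<noteq> f v)"

text \<open>
  The least element exists whenever \<open>G\<close> is a finite simple graph
  (lemma \<open>ex_proper_coloring\<close> below).
\<close>

definition chromatic_number :: "'a pair_pre_digraph \<Rightarrow> nat" where
  "chromatic_number G = (LEAST c. \<exists>f. proper_coloring G c f)"

text \<open>No subtraction truncates when \<open>i\<close> and \<open>j\<close> are in \<open>{1..n}\<close>.\<close>

definition cyc_dist :: "nat \<Rightarrow> nat \<Rightarrow> nat \<Rightarrow> nat" where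
  "cyc_dist n i j = (if i \<le> j then min (j - i) (n + i - j) else min (i - j) (n + j - i))"

definition stable :: "nat \<Rightarrow> nat \<Rightarrow> nat set \<Rightarrow> bool" where
  "stable n s A \<longleftrightarrow> (\<forall>i \<in> A. \<forall>j \<in> A. i \<noteq> j \<longrightarrow> s \<le> cyc_dist n i j)"

definition stable_subsets :: "nat \<Rightarrow> nat \<Rightarrow> nat \<Rightarrow> nat set set" where
  "stable_subsets n k s = {A. A \<subseteq> {1..n} \<and> card A = k \<and> stable n s A}"

text \<open>
  The requirement \<open>A \<noteq> B\<close> only matters for \<open>k = 0\<close>, where the empty set is disjoint from itself.
\<close>

definition stable_kneser_graph :: "nat \<Rightarrow> nat \<Rightarrow> nat \<Rightarrow> nat set pair_pre_digraph" where
  "stable_kneser_graph n k s =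
     \<lparr> pverts = stable_subsets n k s,
       parcs = {(A, B). A \<in> stable_subsets n k s \<and> B \<in> stable_subsets n k s \<and>
                        A \<noteq> B \<and> A \<inter> B = {}} \<rparr>"

lemma finite_stable_subsets: "finite (stable_subsets n k s)"
  by (rule finite_subset[of _ "Pow {1..n}"]) (auto simp: stable_subsets_def)

lemma pair_graph_stable_kneser_graph: "pair_graph (stable_kneser_graph n k s)"
proof unfold_locales
  let ?G = "stable_kneser_graph n k s"
  show "finite (pverts ?G)"
    by (simp add: stable_kneser_graph_def finite_stable_subsets)
  show "finite (parcs ?G)"
    by (rule finite_subset[of _ "stable_subsets n k s \<times> stable_subsets n k s"])
       (auto simp: stable_kneser_graph_def finite_stable_subsets)
  have "sym (parcs ?G)"
    unfolding sym_def stable_kneser_graph_def by (simp add: Int_commute eq_commute)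
  then show "symmetric (with_proj ?G)"
    by (simp add: symmetric_def arcs_ends_def arc_to_ends_def)
qed (auto simp: stable_kneser_graph_def)

lemma ex_proper_coloring:
  assumes "pair_graph G"
  shows "\<exists>c f. proper_coloring G c f"
proof -
  interpret pair_graph G by fact
  have "finite (pverts G)" by (rule pair_finite_verts)
  from finite_imp_inj_to_nat_seg[OF this] obtain n :: nat and f :: "'a \<Rightarrow> nat"
    where f: "f ` pverts G = {i. i < n}" "inj_on f (pverts G)"
    by auto
  have "f u \<noteq> f v" if "(u, v) \<in> parcs G" for u v
  proof -
    have "u \<in> pverts G" "v \<in> pverts G" "u \<noteq> v"
      using in_arcsD1[OF that] in_arcsD2[OF that] no_loops'[OF that] by blast+
    then show ?thesis using f(2) by (auto dest: inj_onD)
  qed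
  then have "proper_coloring G n f"
    using f(1) by (auto simp: proper_coloring_def)
  then show ?thesis by blast
qed

end

theory Submission
  imports Defs
begin

text \<open>
  The lower bound goes by induction on \<open>n\<close>. If some colour class is a star, i.e. all its members
  contain a common point \<open>x\<close>, deleting \<open>x\<close> from the cycle saves a colour: a set that is stable in
  the shorter cycle stays stable when \<open>x\<close> is put back. Otherwise \<open>n - 7\<close> intersecting families
  without a common point would have to cover all stable triples, and these families are too small.
  For \<open>n \<ge> 17\<close> a Hilton--Milner argument bounds each of them by \<open>3 * (n - 8) - 2\<close>, which is less
  than the \<open>n * (n - 8) / 6\<close> needed on average. For \<open>10 \<le> n \<le> 16\<close> plain counting is not
  sufficient (it fails for \<open>n = 12, 13, 14\<close>), but counting with suitable rotation-invariant weights
  is; there the weight of an intersecting family without a common point is bounded by a verified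
  branch-and-bound search, run by the simplifier.
\<close>

section \<open>A branch-and-bound search for intersecting families\<close>

text \<open>
  The search is evaluated by the simplifier. Hence the branching on truth values that are themselves
  results of computations is delegated to functions with Boolean patterns (\<open>cons_if\<close>, \<open>free1\<close>,
  \<open>color1\<close> etc.): in contrast to \<open>if\<close>, they do not make the simplifier traverse data that is
  already in normal form again.
\<close>

fun cons_if :: "bool \<Rightarrow> 'a \<Rightarrow> 'a list \<Rightarrow> 'a list" where
  "cons_if True x xs = x # xs"
| "cons_if False x xs = xs"

fun meets :: "bool list \<Rightarrow> bool list \<Rightarrow> bool" where
  "meets [] ys = False"
| "meets (x # xs) [] = False"
| "meets (True # xs) (True # ys) = True"
| "meets (True # xs) (False # ys) = meets xs ys"
| "meets (False # xs) (y # ys) = meets xs ys"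

text \<open>A weight together with the characteristic bit list of a set.\<close>

type_synonym vtx = "int \<times> bool list"

fun nbrs :: "bool list \<Rightarrow> vtx list \<Rightarrow> vtx list" where
  "nbrs m [] = []"
| "nbrs m ((w, u) # us) = cons_if (meets m u) (w, u) (nbrs m us)"

fun common :: "bool list \<Rightarrow> bool list list \<Rightarrow> bool list list" where
  "common m [] = []"
| "common m (x # xs) = cons_if (meets x m) x (common m xs)"

fun split_cons :: "bool \<Rightarrow> 'a \<Rightarrow> 'a list \<times> 'a list \<Rightarrow> 'a list \<times> 'a list" where
  "split_cons True v (S, R) = (v # S, R)"
| "split_cons False v (S, R) = (S, v # R)"

fun split :: "bool list \<Rightarrow> vtx list \<Rightarrow> vtx list \<times> vtx list" where
  "split x [] = ([], [])"
| "split x ((w, u) # us) = split_cons (meets x u) (w, u) (split x us)"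

fun free :: "bool list \<Rightarrow> vtx list \<Rightarrow> bool" and free1 :: "bool \<Rightarrow> bool list \<Rightarrow> vtx list \<Rightarrow> bool" where
  "free m [] = True"
| "free m ((w, u) # us) = free1 (meets m u) m us"
| "free1 True m us = False"
| "free1 False m us = free m us"

text \<open>Vertices heavier than \<open>w\<close> stay in the queue, so the first vertex remains
  the heaviest of its class and \<open>w\<close> is the price of the whole class.\<close>

function extend_class :: "int \<Rightarrow> vtx list \<Rightarrow> vtx list \<Rightarrow> vtx list \<times> vtx list"
  and extend_class1 :: "bool \<Rightarrow> int \<Rightarrow> vtx list \<Rightarrow> vtx \<Rightarrow> vtx list \<Rightarrow> vtx list \<times> vtx list"
  and extend_class2 :: "bool \<Rightarrow> int \<Rightarrow> vtx list \<Rightarrow> vtx \<Rightarrow> vtx list \<Rightarrow> vtx list \<times> vtx list" where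
  "extend_class w C [] = (C, [])"
| "extend_class w C ((u, m) # Q) = extend_class1 (u \<le> w) w C (u, m) Q"
| "extend_class1 True w C (u, m) Q = extend_class2 (free m C) w C (u, m) Q"
| "extend_class1 False w C v Q = split_cons False v (extend_class w C Q)"
| "extend_class2 True w C v Q = extend_class w (v # C) Q"
| "extend_class2 False w C v Q = split_cons False v (extend_class w C Q)"
  by pat_completeness auto
termination
  by (relation "measure (case_sum (\<lambda>(_, _, Q). 3 * length Q)
        (case_sum (\<lambda>(_, _, _, _, Q). 3 * length Q + 2) (\<lambda>(_, _, _, _, Q). 3 * length Q + 1)))") auto

text \<open>
  The members of an intersecting family in a list of pairwise disjoint sets weigh at most as much as
  the heaviest set of the list. \<open>color fs S b Q\<close> greedily moves such lists from \<open>Q\<close> to \<open>S\<close> as long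
  as the budget \<open>b\<close> allows it; an intersecting family within \<open>Q\<close> that weighs more than \<open>b\<close>
  must then contain a vertex of the remaining part of \<open>Q\<close>. The list \<open>fs\<close> serves as fuel, as in \<open>search\<close>.
\<close>

function color :: "'a list \<Rightarrow> vtx list \<Rightarrow> int \<Rightarrow> vtx list \<Rightarrow> vtx list \<times> vtx list"
  and color1 :: "bool \<Rightarrow> 'a list \<Rightarrow> vtx list \<Rightarrow> int \<Rightarrow> vtx \<Rightarrow> vtx list \<Rightarrow> vtx list \<times> vtx list"
  and color2 :: "'a list \<Rightarrow> vtx list \<Rightarrow> int \<Rightarrow> vtx list \<times> vtx list \<Rightarrow> vtx list \<times> vtx list" where
  "color [] S b Q = (S, Q)"
| "color (f # fs) S b [] = (S, [])"
| "color (f # fs) S b ((w, m) # Q) = color1 (w \<le> b) fs S b (w, m) Q"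
| "color1 False fs S b v Q = (S, v # Q)"
| "color1 True fs S b (w, m) Q = color2 fs S (b - w) (extend_class w [(w, m)] Q)"
| "color2 fs S b (C, Q) = color fs (C @ S) b Q"
  by pat_completeness auto
termination
  by (relation "measure (case_sum (\<lambda>(fs, _). 3 * length fs)
        (case_sum (\<lambda>(_, fs, _). 3 * length fs + 2) (\<lambda>(fs, _). 3 * length fs + 1)))") auto

text \<open>Fewer branching vertices mean fewer recursive searches; lengths are compared by walking
  down both lists, without arithmetic.\<close>

fun shorter :: "'a list \<Rightarrow> 'b list \<Rightarrow> bool" where
  "shorter xs [] = False"
| "shorter [] (y # ys) = True"
| "shorter (x # xs) (y # ys) = shorter xs ys"

fun pick :: "bool \<Rightarrow> 'a \<Rightarrow> 'a \<Rightarrow> 'a" where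
  "pick True x y = x"
| "pick False x y = y"

fun better :: "vtx list \<times> vtx list \<Rightarrow> vtx list \<times> vtx list \<Rightarrow> vtx list \<times> vtx list" where
  "better (S, R) (S', R') = pick (shorter R R') (S, R) (S', R')"

text \<open>
  The search branches over a set of vertices one of which occurs in every relevant family: either the
  ones left over by \<open>color\<close>, or the ones avoiding some \<open>x\<close> in \<open>I\<close>.
\<close>

fun best :: "bool list list \<Rightarrow> vtx list \<Rightarrow> vtx list \<times> vtx list \<Rightarrow> vtx list \<times> vtx list" where
  "best I P (S, []) = (S, [])"
| "best [] P (S, r # R) = (S, r # R)"
| "best (x # I) P (S, r # R) = best I P (better (split x P) (S, r # R))"

text \<open>
  \<open>search fs I P b\<close> establishes that every intersecting family within \<open>P\<close> that contains, for each
  \<open>x\<close> in \<open>I\<close>, a set disjoint from \<open>x\<close> weighs at most \<open>b\<close>. In the recursion \<open>I\<close> consists of the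
  singletons of the points common to all vertices chosen so far.
\<close>

function search :: "'a list \<Rightarrow> bool list list \<Rightarrow> vtx list \<Rightarrow> int \<Rightarrow> bool"
  and loop :: "'a list \<Rightarrow> bool list list \<Rightarrow> vtx list \<times> vtx list \<Rightarrow> int \<Rightarrow> bool" where
  "search [] I P b = False"
| "search (f # fs) I P b = loop fs I (best I P (color P [] b P)) b"
| "loop fs I (S, []) b = True"
| "loop fs I (S, (w, m) # R) b \<longleftrightarrow>
     w \<le> b \<and> search fs (common m I) (nbrs m (R @ S)) (b - w) \<and> loop fs I (S, R) b"
  by pat_completeness auto
termination
  by (relation "measures [case_sum (\<lambda>(fs, _). length fs) (\<lambda>(fs, _). length fs),
        case_sum (\<lambda>_. 0) (\<lambda>(_, _, (_, R), _). Suc (length R))]") auto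

fun shift :: "bool list list \<Rightarrow> bool list list" where
  "shift [] = []"
| "shift (x # xs) = (False # x) # shift xs"

fun singles :: "bool list \<Rightarrow> bool list list" where
  "singles [] = []"
| "singles (b # bs) = cons_if b [True] (shift (singles bs))"

text \<open>By symmetry one search per orbit suffices, rooted at its first vertex; orbits already
  treated are discarded. The vertex list doubles as fuel, one entry per level of recursion.\<close>

fun check :: "int \<Rightarrow> vtx list list \<Rightarrow> bool" where
  "check W [] = True"
| "check W ([] # Us) = check W Us"
| "check W (((w, m) # U) # Us) \<longleftrightarrow>
     w \<le> W \<and> search (U @ concat Us) (singles m) (nbrs m (U @ concat Us)) (W - w) \<and> check W Us"

text \<open>
  The set \<open>{0, g, g + h}\<close>. An orbit under rotation is described by its length, its weight and the
  first two gaps \<open>g\<close> and \<open>h\<close> of a representative.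
\<close>

definition rep :: "nat \<Rightarrow> nat \<Rightarrow> nat \<Rightarrow> bool list" where
  "rep n g h = True # replicate (g - 1) False @ True # replicate (h - 1) False @
     True # replicate (n - g - h - 1) False"

fun orbit :: "nat \<Rightarrow> int \<Rightarrow> bool list \<Rightarrow> vtx list" where
  "orbit 0 w m = []"
| "orbit (Suc k) w m = (w, m) # orbit k w (rotate1 m)"

definition orbits :: "nat \<Rightarrow> (nat \<times> int \<times> nat \<times> nat) list \<Rightarrow> vtx list list" where
  "orbits n = map (\<lambda>(k, w, g, h). orbit k w (rep n g h))"

lemmas search_rules = cons_if.simps meets.simps nbrs.simps common.simps split_cons.simps split.simps
  free.simps free1.simps extend_class.simps extend_class1.simps extend_class2.simps color.simps color1.simps color2.simps
  shorter.simps pick.simps better.simps best.simps search.simps loop.simps shift.simps singles.simps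
  check.simps append.simps concat.simps simp_thms arith_simps rel_simps
  diff_numeral_special

declare check.simps [simp del]

section \<open>Soundness of the search\<close>

definition pts :: "bool list \<Rightarrow> nat set" where
  "pts m = {i. i < length m \<and> m ! i}"

lemma pts_Nil [simp]: "pts [] = {}"
  by (simp add: pts_def)

lemma pts_Cons [simp]: "pts (b # m) = (if b then {0} else {}) \<union> Suc ` pts m"
  by (auto simp: pts_def nth_Cons less_Suc_eq_0_disj)

lemma meets_iff: "meets xs ys \<longleftrightarrow> pts xs \<inter> pts ys \<noteq> {}"
  by (induction xs ys rule: meets.induct) auto

lemma cons_if_eq: "cons_if b x xs = (if b then x # xs else xs)"
  by (cases b) auto

lemma nbrs_eq: "nbrs m us = filter (\<lambda>u. meets m (snd u)) us"
  by (induction m us rule: nbrs.induct) (simp_all add: cons_if_eq)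

lemma common_eq: "common m xs = filter (\<lambda>x. meets x m) xs"
  by (induction m xs rule: common.induct) (simp_all add: cons_if_eq)

lemma split_cons_eq:
  "split_cons b v p = (if b then (v # fst p, snd p) else (fst p, v # snd p))"
  by (cases b; cases p) auto

lemma split_eq: "split x us = (filter (\<lambda>u. meets x (snd u)) us, filter (\<lambda>u. \<not> meets x (snd u)) us)"
  by (induction x us rule: split.induct) (simp_all add: split_cons_eq)

lemma free_iff: "free m us \<longleftrightarrow> (\<forall>u \<in> set us. \<not> meets m (snd u))"
  and free1_iff: "free1 b m us \<longleftrightarrow> \<not> b \<and> (\<forall>u \<in> set us. \<not> meets m (snd u))"
  by (induction m us and b m us rule: free_free1.induct) auto

definition intersecting :: "vtx set \<Rightarrow> bool" where
  "intersecting F \<longleftrightarrow> (\<forall>u \<in> F. \<forall>v \<in> F. meets (snd u) (snd v))"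

lemma intersecting_subset: "intersecting F \<Longrightarrow> G \<subseteq> F \<Longrightarrow> intersecting G"
  by (auto simp: intersecting_def)

definition color_class :: "int \<Rightarrow> vtx list \<Rightarrow> bool" where
  "color_class w C \<longleftrightarrow> (\<forall>u \<in> set C. fst u \<le> w) \<and>
     (\<forall>u \<in> set C. \<forall>v \<in> set C. u \<noteq> v \<longrightarrow> \<not> meets (snd u) (snd v))"

lemma meets_commute: "meets xs ys \<longleftrightarrow> meets ys xs"
  by (auto simp: meets_iff)

text \<open>A vertex joins the class only after \<open>free\<close> has found it disjoint from all
  of it. The hypotheses on \<open>b1\<close> and \<open>b2\<close> tie the Boolean arguments to the
  tests they stand for.\<close>

lemma
  extend_class_sound: "color_class w C \<Longrightarrow> color_class w (fst (extend_class w C Q)) \<and>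
    set (fst (extend_class w C Q)) \<union> set (snd (extend_class w C Q)) = set C \<union> set Q" and
  extend_class1_sound: "color_class w C \<Longrightarrow> b1 = (fst v \<le> w) \<Longrightarrow> color_class w (fst (extend_class1 b1 w C v Q)) \<and>
    set (fst (extend_class1 b1 w C v Q)) \<union> set (snd (extend_class1 b1 w C v Q)) = set C \<union> set (v # Q)" and
  extend_class2_sound: "color_class w C \<Longrightarrow> fst v \<le> w \<Longrightarrow> b2 = free (snd v) C \<Longrightarrow> color_class w (fst (extend_class2 b2 w C v Q)) \<and>
    set (fst (extend_class2 b2 w C v Q)) \<union> set (snd (extend_class2 b2 w C v Q)) = set C \<union> set (v # Q)"
proof (induction w C Q and b1 w C v Q and b2 w C v Q rule: extend_class_extend_class1_extend_class2.induct)
  case (5 w C v Q)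
  have "color_class w (v # C)"
    using 5(2-4) by (auto simp: color_class_def free_iff meets_commute)
  then show ?case using 5(1) by auto
qed (auto simp: split_cons_eq)

text \<open>Two different members of \<open>F\<close> would be disjoint, so \<open>F\<close> has at
  most one member; \<open>0 \<le> w\<close> settles the empty family.\<close>

lemma color_class_weight:
  assumes "color_class w C" "F \<subseteq> set C" "intersecting F" "0 \<le> w"
  shows "(\<Sum>v\<in>F. fst v) \<le> w"
proof (cases "F = {}")
  case False
  then obtain u where "u \<in> F" by blast
  have "v = u" if "v \<in> F" for v
  proof (rule ccontr)
    assume "v \<noteq> u"
    then have "\<not> meets (snd v) (snd u)"
      using assms(1,2) \<open>u \<in> F\<close> that by (auto simp: color_class_def)
    then show False using assms(3) \<open>u \<in> F\<close> that by (auto simp: intersecting_def)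
  qed
  then have "F = {u}" using \<open>u \<in> F\<close> by blast
  then show ?thesis using assms(1,2) by (auto simp: color_class_def)
qed (use assms in simp)

lemma weight_le_color_class:
  assumes Q: "\<And>F. F \<subseteq> set Q \<Longrightarrow> intersecting F \<Longrightarrow> F \<inter> R = {} \<Longrightarrow> (\<Sum>v\<in>F. fst v) \<le> b - w"
    and "color_class w C" "0 \<le> w" "F \<subseteq> set C \<union> set Q" "intersecting F" "F \<inter> R = {}"
  shows "(\<Sum>v\<in>F. fst v) \<le> (b :: int)"
proof -
  have "finite F" using assms(4) finite_subset by blast
  then have "(\<Sum>v\<in>F. fst v) = (\<Sum>v\<in>F \<inter> set C. fst v) + (\<Sum>v\<in>F - set C. fst v)"
    by (metis sum.Int_Diff)
  moreover have "(\<Sum>v\<in>F \<inter> set C. fst v) \<le> w"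
    using assms by (intro color_class_weight[of _ C]) (auto intro: intersecting_subset)
  moreover have "(\<Sum>v\<in>F - set C. fst v) \<le> b - w"
    using assms by (intro Q) (auto intro: intersecting_subset)
  ultimately show ?thesis by linarith
qed

text \<open>\<open>R\<close> hits every intersecting family within \<open>P\<close> that exceeds the
  budget, so branching over \<open>R\<close> alone is enough.\<close>

definition fits :: "vtx set \<Rightarrow> vtx set \<Rightarrow> int \<Rightarrow> bool" where
  "fits P R b \<longleftrightarrow> (\<forall>F \<subseteq> P. intersecting F \<longrightarrow> F \<inter> R = {} \<longrightarrow> (\<Sum>v\<in>F. fst v) \<le> b)"

lemma fits_rest: "0 \<le> b \<Longrightarrow> fits P P b"
  unfolding fits_def by (metis Int_absorb2 sum.empty)

text \<open>Each class costs at most its heaviest weight, which is taken off the budget. Once budget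
  or fuel runs out, all that is left is branched over, and a family avoiding all of it is
  empty.\<close>

lemma
  color_sound: "0 \<le> b \<Longrightarrow> \<forall>v \<in> set Q. 0 \<le> fst v \<Longrightarrow>
     set (fst (color fs S b Q)) \<union> set (snd (color fs S b Q)) = set S \<union> set Q \<and>
     fits (set Q) (set (snd (color fs S b Q))) b" and
  color1_sound: "0 \<le> b \<Longrightarrow> \<forall>v \<in> set (v # Q). 0 \<le> fst v \<Longrightarrow> b1 = (fst v \<le> b) \<Longrightarrow>
     set (fst (color1 b1 fs S b v Q)) \<union> set (snd (color1 b1 fs S b v Q)) = set S \<union> set (v # Q) \<and>
     fits (set (v # Q)) (set (snd (color1 b1 fs S b v Q))) b" and
  color2_sound: "0 \<le> b \<Longrightarrow> \<forall>v \<in> set (snd p). 0 \<le> fst v \<Longrightarrow>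
     set (fst (color2 fs S b p)) \<union> set (snd (color2 fs S b p)) = set S \<union> set (fst p) \<union> set (snd p) \<and>
     fits (set (snd p)) (set (snd (color2 fs S b p))) b"
proof (induction fs S b Q and b1 fs S b v Q and fs S b p rule: color_color1_color2.induct)
  case (5 fs S b w m Q)
  let ?p = "extend_class w [(w, m)] Q"
  have cc: "color_class w [(w, m)]" by (simp add: color_class_def)
  note c = extend_class_sound[OF cc, of Q]
  have "set (snd ?p) \<subseteq> set [(w, m)] \<union> set Q" using c by blast
  then have nonneg: "\<forall>v \<in> set (snd ?p). 0 \<le> fst v" using 5(3) by auto
  note IH = 5(1)[OF _ nonneg]
  have "fits (set ((w, m) # Q)) (set (snd (color2 fs S (b - w) ?p))) b"
    unfolding fits_def
  proof (intro allI impI)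
    fix F assume F: "F \<subseteq> set ((w, m) # Q)" "intersecting F" "F \<inter> set (snd (color2 fs S (b - w) ?p)) = {}"
    show "(\<Sum>v\<in>F. fst v) \<le> b"
    proof (rule weight_le_color_class[where C = "fst ?p" and Q = "snd ?p" and w = w])
      show "F \<subseteq> set (fst ?p) \<union> set (snd ?p)" using F(1) c by auto
    qed (use F c IH 5(3,4) in \<open>auto simp: fits_def\<close>)
  qed
  then show ?case using IH c 5(4) by auto
qed (auto simp: fits_rest)

definition branching :: "vtx set \<Rightarrow> int \<Rightarrow> vtx list \<Rightarrow> vtx list \<times> vtx list \<Rightarrow> bool" where
  "branching F b P p \<longleftrightarrow> set (fst p) \<union> set (snd p) = set P \<and>
     (F \<inter> set (snd p) = {} \<longrightarrow> (\<Sum>v\<in>F. fst v) \<le> b)"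

text \<open>The member of \<open>F\<close> disjoint from \<open>x\<close> lies in the second
  component, so \<open>F\<close> cannot avoid that component.\<close>

lemma branching_split:
  assumes "F \<subseteq> set P" "\<exists>v \<in> F. \<not> meets x (snd v)"
  shows "branching F b P (split x P)"
  using assms by (auto simp: branching_def split_eq)

lemma branching_better: "branching F b P p \<Longrightarrow> branching F b P q \<Longrightarrow> branching F b P (better p q)"
  by (cases p; cases q; cases "shorter (snd p) (snd q)") auto

lemma branching_best:
  assumes "F \<subseteq> set P" "\<forall>x \<in> set I. \<exists>v \<in> F. \<not> meets x (snd v)" "branching F b P p"
  shows "branching F b P (best I P p)"
  using assms by (induction I P p rule: best.induct) (auto intro: branching_split branching_better)

text \<open>\<open>loop\<close> takes the branching vertices in turn. If the current one is in
  \<open>F\<close>, the rest of \<open>F\<close> lies among its neighbours and the budget drops by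
  its weight; otherwise it is discarded for good. When none is left, the last hypothesis of
  \<open>loop_sound\<close> gives the bound.\<close>

lemma
  fixes fs :: "'a list"
  shows search_sound: "search fs I P b \<Longrightarrow> 0 \<le> b \<Longrightarrow> \<forall>v \<in> set P. 0 \<le> fst v \<Longrightarrow> F \<subseteq> set P \<Longrightarrow>
      intersecting F \<Longrightarrow> \<forall>x \<in> set I. \<exists>v \<in> F. \<not> meets x (snd v) \<Longrightarrow> (\<Sum>v\<in>F. fst v) \<le> b"
    and loop_sound: "loop fs I p b \<Longrightarrow> \<forall>v \<in> set (fst p) \<union> set (snd p). 0 \<le> fst v \<Longrightarrow>
      F \<subseteq> set (fst p) \<union> set (snd p) \<Longrightarrow>
      intersecting F \<Longrightarrow> \<forall>x \<in> set I. \<exists>v \<in> F. \<not> meets x (snd v) \<Longrightarrow>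
      (F \<inter> set (snd p) = {} \<longrightarrow> (\<Sum>v\<in>F. fst v) \<le> b) \<Longrightarrow> (\<Sum>v\<in>F. fst v) \<le> b"
proof (induction fs I P b and fs I p b arbitrary: F and F rule: search_loop.induct)
  case (2 f fs I P b)
  note c = color_sound[OF 2(3,4), of P "[]"]
  have "branching F b P (best I P (color P [] b P))"
    by (rule branching_best) (use c 2(5-7) in \<open>auto simp: fits_def branching_def\<close>)
  then show ?case
    by (intro 2(1)) (use 2(2-) in \<open>auto simp: branching_def\<close>)
next
  case (4 fs I S w m R b)
  show ?case
  proof (cases "(w, m) \<in> F")
    case True
    let ?F = "F - {(w, m)}"
    have "(\<Sum>v\<in>?F. fst v) \<le> b - w"
    proof (rule 4(1))
      show "?F \<subseteq> set (nbrs m (R @ S))"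
      proof
        fix v assume v: "v \<in> ?F"
        then have "meets m (snd v)" using 4(6) True by (auto simp: intersecting_def)
        then show "v \<in> set (nbrs m (R @ S))" using 4(5) v by (auto simp: nbrs_eq)
      qed
      \<comment> \<open>A witness disjoint from an \<open>x\<close> that meets \<open>m\<close> is
        not \<open>(w, m)\<close> itself, so it survives the removal.\<close>
      show "\<forall>x\<in>set (common m I). \<exists>v\<in>?F. \<not> meets x (snd v)"
        using 4(7) by (fastforce simp: common_eq)
      show "\<forall>v\<in>set (nbrs m (R @ S)). 0 \<le> fst v"
        using 4(4) by (force simp: nbrs_eq)
    qed (use 4(3-6) in \<open>auto intro: intersecting_subset\<close>)
    moreover have "finite F" using 4(5) finite_subset by auto
    ultimately show ?thesis using True by (simp add: sum.remove[of F "(w, m)"])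
  next
    case False
    show ?thesis
    proof (rule 4(2)[OF _ _ _ 4(6,7)])
      show "F \<inter> set (snd (S, R)) = {} \<longrightarrow> (\<Sum>v\<in>F. fst v) \<le> b"
        using 4(8) False by simp
    qed (use 4(3-5) False in auto)
  qed
next
  case (3 fs I S b)
  from 3(6) show ?case by simp
next
  case (1 I P b)
  from 1(1) show ?case by simp
qed

lemma set_shift: "set (shift xs) = Cons False ` set xs"
  by (induction xs rule: shift.induct) auto

lemma pts_singles: "pts ` set (singles m) = (\<lambda>i. {i}) ` pts m"
proof (induction m)
  case (Cons b m)
  have "pts ` set (shift (singles m)) = (\<lambda>x. Suc ` pts x) ` set (singles m)"
    by (simp add: set_shift image_image)
  also have "\<dots> = image Suc ` (pts ` set (singles m))"
    by (simp add: image_image)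
  also have "\<dots> = (\<lambda>i. {Suc i}) ` pts m"
    by (simp add: Cons.IH image_image)
  finally show ?case
    by (simp add: cons_if_eq image_image)
qed simp

definition nontrivial :: "vtx set \<Rightarrow> bool" where
  "nontrivial F \<longleftrightarrow> intersecting F \<and> (\<forall>x. \<exists>v \<in> F. x \<notin> pts (snd v))"

text \<open>Only points of \<open>m\<close> could be common to a family containing \<open>m\<close>,
  so the singletons of these points are what the rest of \<open>F\<close> has to avoid.\<close>

lemma nontrivial_search:
  assumes "search fs (singles m) (nbrs m P) (W - w)" "w \<le> W" "\<forall>v \<in> set P. 0 \<le> fst v"
    and F: "nontrivial F" "F \<subseteq> insert (w, m) (set P)" "(w, m) \<in> F"
  shows "(\<Sum>v\<in>F. fst v) \<le> W"
proof -
  let ?F = "F - {(w, m)}"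
  have "(\<Sum>v\<in>?F. fst v) \<le> W - w"
  proof (rule search_sound)
    show "?F \<subseteq> set (nbrs m P)"
    proof
      fix v assume v: "v \<in> ?F"
      then have "meets m (snd v)" using F by (auto simp: intersecting_def nontrivial_def)
      then show "v \<in> set (nbrs m P)" using F(2) v by (auto simp: nbrs_eq)
    qed
    show "\<forall>x\<in>set (singles m). \<exists>v\<in>?F. \<not> meets x (snd v)"
    proof
      fix x assume "x \<in> set (singles m)"
      then obtain i where i: "pts x = {i}" "i \<in> pts m"
        using pts_singles[of m] by blast
      then show "\<exists>v\<in>?F. \<not> meets x (snd v)"
        using F(1) unfolding nontrivial_def meets_iff by force
    qed
  qed (use assms in \<open>auto simp: nbrs_eq nontrivial_def intro: intersecting_subset\<close>)
  moreover have "finite F" using F(2) finite_subset by auto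
  ultimately show ?thesis using F(3) by (simp add: sum.remove[of F "(w, m)"])
qed

section \<open>Rotations\<close>

lemma ex_rotation:
  assumes "p < (n :: nat)"
  shows "\<exists>i<n. (k + i) mod n = p"
proof (intro exI conjI)
  let ?i = "(p + (n - k mod n)) mod n"
  have "k mod n < n" using assms by simp
  then have "k mod n + (p + (n - k mod n)) = p + n" by simp
  then have "(k mod n + (p + (n - k mod n)) mod n) mod n = p"
    using assms by (simp add: mod_add_right_eq)
  then show "(k + ?i) mod n = p" by (simp add: mod_add_left_eq)
  show "?i < n" using assms by simp
qed

lemma pts_rotate:
  assumes "length m = n" "0 < n"
  shows "pts (rotate k m) = {i. i < n \<and> (k + i) mod n \<in> pts m}"
  using assms by (auto simp: pts_def nth_rotate)

lemma rotate_period: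
  assumes "rotate k m = m"
  shows "rotate j m = rotate (j mod k) m"
proof -
  have "rotate (k * q) m = m" for q
    by (induction q) (simp_all add: assms flip: rotate_rotate)
  then have "rotate (j mod k + k * (j div k)) m = rotate (j mod k) m"
    by (metis rotate_rotate)
  then show ?thesis by simp
qed

lemma inj_rotate: "inj (rotate k)"
  unfolding rotate_def by (rule inj_fn[OF inj_rotate1])

definition spin :: "nat \<Rightarrow> vtx \<Rightarrow> vtx" where
  "spin k v = (fst v, rotate k (snd v))"

lemma sum_spin: "(\<Sum>v\<in>spin k ` F. fst v) = (\<Sum>v\<in>F. fst v)"
proof -
  have "inj_on (spin k) F"
    by (rule inj_onI) (simp add: spin_def prod_eq_iff inj_eq[OF inj_rotate])
  then have "(\<Sum>v\<in>spin k ` F. fst v) = (\<Sum>v\<in>F. fst (spin k v))"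
    by (simp add: sum.reindex)
  then show ?thesis by (simp add: spin_def)
qed

lemma nontrivial_spin:
  assumes F: "nontrivial F" and n: "0 < n" "\<forall>v \<in> F. length (snd v) = n"
  shows "nontrivial (spin k ` F)"
  unfolding nontrivial_def intersecting_def
proof (intro conjI ballI allI)
  fix u v assume "u \<in> spin k ` F" "v \<in> spin k ` F"
  then obtain u' v' where uv: "u' \<in> F" "v' \<in> F" "u = spin k u'" "v = spin k v'" by blast
  then have "meets (snd u') (snd v')"
    using F by (simp add: nontrivial_def intersecting_def)
  then obtain p where p: "p \<in> pts (snd u')" "p \<in> pts (snd v')"
    by (auto simp: meets_iff)
  moreover have "p < n" using p uv n(2) by (auto simp: pts_def)
  then obtain i where "i < n" "(k + i) mod n = p" using ex_rotation by blast
  ultimately have "i \<in> pts (snd u) \<inter> pts (snd v)"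
    using uv n by (simp add: spin_def pts_rotate)
  then show "meets (snd u) (snd v)" by (auto simp: meets_iff)
next
  fix x
  obtain v where "v \<in> F" "(k + x) mod n \<notin> pts (snd v)"
    using F unfolding nontrivial_def by blast
  then show "\<exists>v\<in>spin k ` F. x \<notin> pts (snd v)"
    using n by (auto simp: spin_def pts_rotate intro!: bexI[of _ v])
qed

text \<open>\<open>k\<close> may be any period of \<open>m\<close>; periodicity makes the list
  closed under rotation.\<close>

definition is_orbit :: "nat \<Rightarrow> vtx list \<Rightarrow> bool" where
  "is_orbit n U \<longleftrightarrow> (\<exists>k w m. U = orbit k w m \<and> rotate k m = m \<and> length m = n \<and> 0 \<le> w)"

lemma set_orbit: "set (orbit k w m) = (\<lambda>i. (w, rotate i m)) ` {..<k}"
proof (induction k w m rule: orbit.induct)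
  case (2 k w m)
  have "{..<Suc k} = insert 0 (Suc ` {..<k})" by (auto simp: less_Suc_eq_0_disj)
  then show ?case using 2
    by (simp add: image_image rotate1_rotate_swap)
qed simp

lemma is_orbitD:
  assumes "is_orbit n U" "v \<in> set U"
  shows "0 \<le> fst v" "length (snd v) = n" "spin j v \<in> set U" "\<exists>j. spin j v = hd U"
proof -
  obtain k w m where U: "U = orbit k w m" "rotate k m = m" "length m = n" "0 \<le> w"
    using assms by (auto simp: is_orbit_def)
  then obtain i where i: "i < k" "v = (w, rotate i m)"
    using assms by (auto simp: set_orbit)
  then show "0 \<le> fst v" "length (snd v) = n" using U by auto
  have "rotate (j + i) m = rotate ((j + i) mod k) m"
    using rotate_period[OF U(2)] by blast
  then show "spin j v \<in> set U"
    using U i by (auto simp: spin_def set_orbit rotate_rotate)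
  have "spin (k - i) v = (w, m)"
    using U i by (simp add: spin_def rotate_rotate)
  moreover have "hd U = (w, m)" using U(1) i(1) by (cases k) auto
  ultimately have "spin (k - i) v = hd U" by (rule trans[OF _ sym])
  then show "\<exists>j. spin j v = hd U" by blast
qed

theorem check_sound:
  assumes "check W Us" "\<forall>U \<in> set Us. is_orbit n U" "0 < n"
    and "nontrivial F" "F \<subseteq> set (concat Us)"
  shows "(\<Sum>v\<in>F. fst v) \<le> W"
  using assms
proof (induction W Us rule: check.induct)
  case (1 W)
  then show ?case by (auto simp: nontrivial_def)
next
  case (2 W Us)
  then show ?case by (simp add: check.simps)
next
  case (3 W w m U Us)
  let ?U = "(w, m) # U"
  show ?case
  proof (cases "F \<inter> set ?U = {}")
    case True
    show ?thesis
      by (rule 3(1)) (use 3(2-) True in \<open>auto simp: check.simps\<close>)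
  next
    case False
    then obtain v where v: "v \<in> F" "v \<in> set ?U" by blast
    have orb: "is_orbit n ?U" using 3(3) by simp
    obtain j where j: "spin j v = (w, m)" using is_orbitD(4)[OF orb v(2)] by auto
    have orb': "\<exists>U \<in> set (?U # Us). is_orbit n U \<and> u \<in> set U" if "u \<in> set (concat (?U # Us))" for u
      using 3(3) that unfolding set_concat by blast
    have "(\<Sum>v\<in>spin j ` F. fst v) \<le> W"
    proof (rule nontrivial_search)
      show "search (U @ concat Us) (singles m) (nbrs m (U @ concat Us)) (W - w)" "w \<le> W"
        using 3(2) by (simp_all add: check.simps)
      show "\<forall>v\<in>set (U @ concat Us). 0 \<le> fst v"
      proof
        fix u assume "u \<in> set (U @ concat Us)"
        then have "u \<in> set (concat (?U # Us))" by simp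
        then show "0 \<le> fst u" using orb' is_orbitD(1) by blast
      qed
      have "\<forall>v\<in>F. length (snd v) = n"
        using orb' is_orbitD(2) 3(6) by blast
      then show "nontrivial (spin j ` F)"
        by (rule nontrivial_spin[OF 3(5,4)])
      have "spin j u \<in> set (concat (?U # Us))" if "u \<in> F" for u
      proof -
        have "u \<in> set (concat (?U # Us))" using 3(6) that by blast
        then obtain U' where U': "U' \<in> set (?U # Us)" "is_orbit n U'" "u \<in> set U'"
          using orb' by blast
        then have "spin j u \<in> set U'" using is_orbitD(3) by blast
        then show ?thesis using U'(1) unfolding set_concat by blast
      qed
      then have "spin j ` F \<subseteq> set (concat (?U # Us))" by blast
      then show "spin j ` F \<subseteq> insert (w, m) (set (U @ concat Us))" by simp
      show "(w, m) \<in> spin j ` F" using imageI[OF v(1), of "spin j"] j by simp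
    qed
    then show ?thesis by (simp add: sum_spin)
  qed
qed

section \<open>Stable triples as bit masks\<close>

text \<open>Any two of three points are neighbours in the cyclic order, so stability is a lower
  bound on the three gaps; the last inequality is the gap across \<open>n\<close>.\<close>

lemma stable_subsets_3_3_iff:
  "A \<in> stable_subsets n 3 3 \<longleftrightarrow>
     (\<exists>a b c. A = {a, b, c} \<and> 1 \<le> a \<and> a + 3 \<le> b \<and> b + 3 \<le> c \<and> c \<le> n \<and> c + 3 \<le> a + n)"
  (is "_ \<longleftrightarrow> ?R")
proof
  assume A: "A \<in> stable_subsets n 3 3"
  then obtain x y z where xyz: "A = {x, y, z}" "x \<noteq> y" "y \<noteq> z" "x \<noteq> z"
    by (auto simp: stable_subsets_def card_3_iff)
  have *: ?R if "A = {a, b, c}" "a < b" "b < c" for a b c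
  proof -
    have "3 \<le> cyc_dist n a b" "3 \<le> cyc_dist n b c" "3 \<le> cyc_dist n a c" "1 \<le> a" "c \<le> n"
      using A that by (auto simp: stable_subsets_def stable_def)
    then show ?R using that
      by (intro exI[of _ a] exI[of _ b] exI[of _ c]) (auto simp: cyc_dist_def split: if_splits)
  qed
  consider "x < y" "y < z" | "x < z" "z < y" | "y < x" "x < z"
    | "y < z" "z < x" | "z < x" "x < y" | "z < y" "y < x"
    using xyz(2-4) by linarith
  then show ?R
    by cases (use xyz(1) in \<open>blast intro!: *\<close>)+
next
  assume ?R
  then obtain a b c where abc: "A = {a, b, c}" "1 \<le> a" "a + 3 \<le> b" "b + 3 \<le> c" "c \<le> n" "c + 3 \<le> a + n"
    by blast
  then show "A \<in> stable_subsets n 3 3"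
    by (auto simp: stable_subsets_def stable_def cyc_dist_def)
qed

definition nontrivial_intersecting :: "'a set set \<Rightarrow> bool" where
  "nontrivial_intersecting F \<longleftrightarrow> (\<forall>A \<in> F. \<forall>B \<in> F. A \<inter> B \<noteq> {}) \<and> (\<forall>x. \<exists>A \<in> F. x \<notin> A)"

text \<open>\<open>n - 7\<close> is one less than the claimed chromatic number. Colour classes are
  intersecting, so in a colouring with so few colours one of them must have a common point.\<close>

definition uncoverable :: "nat \<Rightarrow> bool" where
  "uncoverable n \<longleftrightarrow> (\<forall>C. (\<forall>i < n - 7. nontrivial_intersecting (C i)) \<longrightarrow>
     (\<Union>i<n - 7. C i) \<noteq> stable_subsets n 3 3)"

lemma sum_cover_le:
  fixes w :: "'a \<Rightarrow> int"
  assumes "\<And>i. i < k \<Longrightarrow> finite (C i)" "\<And>i v. i < k \<Longrightarrow> v \<in> C i \<Longrightarrow> 0 \<le> w v"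
    and "\<And>i. i < k \<Longrightarrow> sum w (C i) \<le> W"
  shows "sum w (\<Union>i<k. C i) \<le> int k * W"
  using assms
proof (induction k)
  case (Suc k)
  let ?U = "\<Union>i<k. C i"
  have "sum w (?U \<union> C k) + sum w (?U \<inter> C k) = sum w ?U + sum w (C k)"
    by (rule sum.union_inter) (use Suc.prems in auto)
  moreover have "0 \<le> sum w (?U \<inter> C k)"
    using Suc.prems by (intro sum_nonneg) auto
  moreover have "sum w ?U \<le> int k * W"
    by (rule Suc.IH) (use Suc.prems less_SucI in blast)+
  moreover have "sum w (C k) \<le> W"
    using Suc.prems by simp
  moreover have "(\<Union>i<Suc k. C i) = ?U \<union> C k"
    by (auto simp: less_Suc_eq)
  ultimately show ?case by (simp add: algebra_simps)
qed simp

lemma pts_replicate_append: "pts (replicate k False @ m) = (+) k ` pts m"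
  by (induction k) (auto simp: image_image)

lemma pts_rep:
  assumes "1 \<le> g" "1 \<le> h" "g + h + 1 \<le> n"
  shows "pts (rep n g h) = {0, g, g + h}" "length (rep n g h) = n"
proof -
  have "pts (replicate k False) = {}" for k
    using pts_replicate_append[of k "[]"] by simp
  then show "pts (rep n g h) = {0, g, g + h}"
    using assms by (simp add: rep_def pts_replicate_append image_image insert_commute)
  show "length (rep n g h) = n"
    using assms by (simp add: rep_def)
qed

lemma mod_eq_iff:
  assumes "s < n" "i < n" "x < (n :: nat)"
  shows "(n - s + i) mod n = x \<longleftrightarrow> i = (s + x) mod n"
proof -
  have "(s + x) mod n = (if s + x < n then s + x else s + x - n)"
    using assms by (simp add: mod_if)
  moreover have "(n - s + i) mod n = (if i < s then n - s + i else i - s)"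
    using assms by (auto simp: mod_if)
  ultimately show ?thesis using assms by auto
qed

text \<open>\<open>rotate\<close> moves bits towards the front, so the copy starting at
  \<open>s\<close> is the rotation by \<open>n - s\<close>.\<close>

lemma pts_rotate_rep:
  assumes "s < n" "1 \<le> g" "1 \<le> h" "g + h + 1 \<le> n"
  shows "pts (rotate (n - s) (rep n g h)) = {s, (s + g) mod n, (s + (g + h)) mod n}"
proof -
  have "pts (rotate (n - s) (rep n g h)) = {i. i < n \<and> (n - s + i) mod n \<in> {0, g, g + h}}"
    using assms by (simp add: pts_rotate pts_rep)
  also have "\<dots> = {s, (s + g) mod n, (s + (g + h)) mod n}"
  proof -
    have "(n - s + i) mod n \<in> {0, g, g + h} \<longleftrightarrow> i \<in> {s, (s + g) mod n, (s + (g + h)) mod n}"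
      if "i < n" for i
      using mod_eq_iff[of s n i 0] mod_eq_iff[of s n i g] mod_eq_iff[of s n i "g + h"] assms that
      by simp
    moreover have "i < n" if "i \<in> {s, (s + g) mod n, (s + (g + h)) mod n}" for i
      using that assms(1) by auto
    ultimately show ?thesis
      by (intro set_eqI, unfold mem_Collect_eq) meson
  qed
  finally show ?thesis .
qed

text \<open>Position \<open>i\<close> of a bit list stands for the point \<open>i + 1\<close> of the cycle.\<close>

lemma triple_stable:
  assumes "s < n" "3 \<le> g" "3 \<le> h" "g + h + 3 \<le> n"
  shows "Suc ` {s, (s + g) mod n, (s + (g + h)) mod n} \<in> stable_subsets n 3 3"
proof -
  have 1: "(s + g) mod n = (if s + g < n then s + g else s + g - n)"
    and 2: "(s + (g + h)) mod n = (if s + (g + h) < n then s + (g + h) else s + (g + h) - n)"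
    using assms by (auto simp: mod_if)
  \<comment> \<open>Depending on which points wrap around, the increasing order starts with the
    first, the third or the second point.\<close>
  consider "s + (g + h) < n" | "s + g < n" "n \<le> s + (g + h)" | "n \<le> s + g"
    by linarith
  then show ?thesis
  proof cases
    case 1
    show ?thesis unfolding stable_subsets_3_3_iff
      by (rule exI[of _ "Suc s"], rule exI[of _ "Suc (s + g)"], rule exI[of _ "Suc (s + (g + h))"])
        (use 1 assms in auto)
  next
    case c: 2
    show ?thesis unfolding stable_subsets_3_3_iff
      by (rule exI[of _ "Suc (s + (g + h) - n)"], rule exI[of _ "Suc s"], rule exI[of _ "Suc (s + g)"])
        (use 2 c assms in auto)
  next
    case c: 3
    show ?thesis unfolding stable_subsets_3_3_iff
      by (rule exI[of _ "Suc (s + g - n)"], rule exI[of _ "Suc (s + (g + h) - n)"], rule exI[of _ "Suc s"])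
        (use 1 2 c assms in auto)
  qed
qed

lemma rotate_rep_stable:
  assumes "3 \<le> g" "3 \<le> h" "g + h + 3 \<le> n"
  shows "Suc ` pts (rotate j (rep n g h)) \<in> stable_subsets n 3 3"
proof -
  define s where "s = (n - j mod n) mod n"
  have n: "0 < n" using assms by simp
  then have s: "s < n" by (simp add: s_def)
  have "(n - s) mod n = j mod n"
    using n by (cases "j mod n = 0") (auto simp: s_def)
  then have "rotate j (rep n g h) = rotate (n - s) (rep n g h)"
    using assms by (simp add: pts_rep rotate_conv_mod[of j] rotate_conv_mod[of "n - s"])
  then show ?thesis
    using pts_rotate_rep[OF s, of g h] triple_stable[OF s assms] assms by simp
qed

section \<open>Orbits of stable triples and weighted counting\<close>

lemma orbits_simps:
  "orbits n [] = []"
  "orbits n ((k, w, g, h) # rs) = orbit k w (rep n g h) # orbits n rs"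
  by (simp_all add: orbits_def)

lemma set_concat_orbits:
  "v \<in> set (concat (orbits n rs)) \<longleftrightarrow>
     (\<exists>k w g h i. (k, w, g, h) \<in> set rs \<and> i < k \<and> v = (w, rotate i (rep n g h)))"
proof -
  have "v \<in> set (concat (orbits n rs)) \<longleftrightarrow>
      (\<exists>r \<in> set rs. v \<in> set (case r of (k, w, g, h) \<Rightarrow> orbit k w (rep n g h)))"
    by (simp add: orbits_def)
  also have "\<dots> \<longleftrightarrow> (\<exists>k w g h i. (k, w, g, h) \<in> set rs \<and> i < k \<and> v = (w, rotate i (rep n g h)))"
    by (simp add: Bex_def split_paired_Ex set_orbit image_iff)
  finally show ?thesis .
qed

text \<open>A triple fixed by a nontrivial rotation has three equal gaps; this is the short orbit,
  of length \<open>n / 3\<close>.\<close>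

definition valid_orbits :: "nat \<Rightarrow> (nat \<times> int \<times> nat \<times> nat) list \<Rightarrow> bool" where
  "valid_orbits n rs \<longleftrightarrow> (\<forall>(k, w, g, h) \<in> set rs. 0 \<le> w \<and> 3 \<le> g \<and> 3 \<le> h \<and> g + h + 3 \<le> n \<and>
     (k = n \<or> g = k \<and> h = k \<and> n = 3 * k))"

lemma rotate_rep_third:
  assumes "0 < k"
  shows "rotate k (rep (3 * k) k k) = rep (3 * k) k k"
proof -
  let ?xs = "True # replicate (k - 1) False"
  have "rep (3 * k) k k = ?xs @ (?xs @ ?xs)"
    by (simp add: rep_def)
  then show ?thesis
    using rotate_append[of ?xs "?xs @ ?xs"] assms by simp
qed

lemma valid_orbitsD:
  assumes "valid_orbits n rs" "(k, w, g, h) \<in> set rs"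
  shows "0 \<le> w" "3 \<le> g" "3 \<le> h" "g + h + 3 \<le> n" "0 < k" "rotate k (rep n g h) = rep n g h"
proof -
  have *: "0 \<le> w" "3 \<le> g" "3 \<le> h" "g + h + 3 \<le> n" "k = n \<or> g = k \<and> h = k \<and> n = 3 * k"
    using assms unfolding valid_orbits_def by auto
  then show "0 \<le> w" "3 \<le> g" "3 \<le> h" "g + h + 3 \<le> n" "0 < k" by auto
  show "rotate k (rep n g h) = rep n g h"
    using * rotate_rep_third[of k] pts_rep(2)[of g h n] by auto
qed

lemma is_orbit_orbits:
  assumes "valid_orbits n rs"
  shows "\<forall>U \<in> set (orbits n rs). is_orbit n U"
proof
  fix U assume "U \<in> set (orbits n rs)"
  then obtain k w g h where r: "(k, w, g, h) \<in> set rs" "U = orbit k w (rep n g h)"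
    by (auto simp: orbits_def)
  note D = valid_orbitsD[OF assms r(1)]
  then show "is_orbit n U"
    unfolding is_orbit_def r(2) using D
    by (intro exI[of _ k] exI[of _ w] exI[of _ "rep n g h"]) (simp add: pts_rep)
qed

lemma orbits_stable:
  assumes "valid_orbits n rs" "v \<in> set (concat (orbits n rs))"
  shows "Suc ` pts (snd v) \<in> stable_subsets n 3 3" "0 \<le> fst v"
proof -
  obtain k w g h i where v: "(k, w, g, h) \<in> set rs" "v = (w, rotate i (rep n g h))"
    using assms(2) unfolding set_concat_orbits by blast
  note D = valid_orbitsD[OF assms(1) v(1)]
  then show "Suc ` pts (snd v) \<in> stable_subsets n 3 3" "0 \<le> fst v"
    using v(2) rotate_rep_stable by simp_all
qed

text \<open>The three alternatives are the cyclic shifts of the gap sequence, that is, the same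
  triple read from each of its points.\<close>

definition covers_gaps :: "nat \<Rightarrow> (nat \<times> nat) set \<Rightarrow> bool" where
  "covers_gaps n G \<longleftrightarrow> (\<forall>g h. 3 \<le> g \<longrightarrow> 3 \<le> h \<longrightarrow> g + h + 3 \<le> n \<longrightarrow>
     (g, h) \<in> G \<or> (h, n - (g + h)) \<in> G \<or> (n - (g + h), g) \<in> G)"

lemma orbits_complete:
  assumes rs: "valid_orbits n rs" "covers_gaps n ((\<lambda>(k, w, g, h). (g, h)) ` set rs)"
    and A: "A \<in> stable_subsets n 3 3"
  shows "\<exists>v \<in> set (concat (orbits n rs)). Suc ` pts (snd v) = A"
proof -
  obtain a b c where abc: "A = {a, b, c}" "1 \<le> a" "a + 3 \<le> b" "b + 3 \<le> c" "c \<le> n" "c + 3 \<le> a + n"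
    using A unfolding stable_subsets_3_3_iff by blast
  define s g h where "s = a - 1" "g = b - a" "h = c - b"
  then have sgh: "A = Suc ` {s, s + g, s + (g + h)}" "3 \<le> g" "3 \<le> h" "g + h + 3 \<le> n"
    "s + (g + h) < n"
    using abc by auto
  have *: ?thesis if G: "(g', h') \<in> (\<lambda>(k, w, g, h). (g, h)) ` set rs"
    and t: "t < n" "A = Suc ` {t, (t + g') mod n, (t + (g' + h')) mod n}" for t g' h'
  proof -
    obtain k w where r: "(k, w, g', h') \<in> set rs" using G by auto
    note r' = valid_orbitsD(2-6)[OF rs(1) this]
    let ?v = "(w, rotate ((n - t) mod k) (rep n g' h'))"
    have "?v \<in> set (concat (orbits n rs))"
      unfolding set_concat_orbits using r r'(4) mod_less_divisor by blast
    moreover have "Suc ` pts (snd ?v) = A"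
      using pts_rotate_rep[of t n g' h'] rotate_period[OF r'(5), of "n - t"] r'(1-3) t by simp
    ultimately show ?thesis by blast
  qed
  \<comment> \<open>The listed gap pair is read off starting from \<open>a\<close>, \<open>b\<close>
    or \<open>c\<close>, respectively.\<close>
  consider "(g, h) \<in> (\<lambda>(k, w, g, h). (g, h)) ` set rs"
    | "(h, n - (g + h)) \<in> (\<lambda>(k, w, g, h). (g, h)) ` set rs"
    | "(n - (g + h), g) \<in> (\<lambda>(k, w, g, h). (g, h)) ` set rs"
    using rs(2) sgh unfolding covers_gaps_def by blast
  then show ?thesis
  proof cases
    case 1
    then show ?thesis
      by (rule *[where t = s]) (use sgh in auto)
  next
    case 2
    have "s + g + (h + (n - (g + h))) = s + n" using sgh by simp
    then show ?thesis
      by (intro *[OF 2, of "s + g"]) (use sgh in \<open>auto simp: insert_commute add.assoc\<close>)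
  next
    case 3
    have "s + (g + h) + (n - (g + h)) = s + n" "s + (g + h) + (n - (g + h) + g) = s + g + n"
      using sgh by simp_all
    then have "(s + (g + h) + (n - (g + h))) mod n = s mod n"
      "(s + (g + h) + (n - (g + h) + g)) mod n = (s + g) mod n"
      by (simp_all only: mod_add_self2)
    moreover have "s mod n = s" "(s + g) mod n = s + g"
      using sgh by simp_all
    ultimately have "(s + (g + h) + (n - (g + h))) mod n = s"
      "(s + (g + h) + (n - (g + h) + g)) mod n = s + g"
      by simp_all
    then have "A = Suc ` {s + (g + h), (s + (g + h) + (n - (g + h))) mod n, (s + (g + h) + (n - (g + h) + g)) mod n}"
      unfolding sgh(1) by (simp only: insert_commute)
    then show ?thesis
      using *[OF 3] sgh(5) by blast
  qed
qed

text \<open>Weighted pigeonhole: \<open>n - 7\<close> families of weight at most \<open>W\<close>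
  cannot reach the total weight. Distinctness keeps the list sum from counting a triple
  twice.\<close>

theorem certificate:
  assumes "check W (orbits n rs)" "valid_orbits n rs" "covers_gaps n ((\<lambda>(k, w, g, h). (g, h)) ` set rs)"
    and "distinct (concat (orbits n rs))"
    and "int (n - 7) * W < sum_list (map fst (concat (orbits n rs)))" "0 < n"
    and C: "\<And>i. i < n - 7 \<Longrightarrow> nontrivial_intersecting (C i)" "(\<Union>i<n - 7. C i) = stable_subsets n 3 3"
  shows False
proof -
  let ?V = "set (concat (orbits n rs))"
  define F where "F i = {v \<in> ?V. Suc ` pts (snd v) \<in> C i}" for i
  have "sum fst (F i) \<le> W" if i: "i < n - 7" for i
  proof (rule check_sound[OF assms(1) is_orbit_orbits[OF assms(2)] assms(6)])
    show "F i \<subseteq> ?V" by (auto simp: F_def)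
    show "nontrivial (F i)"
      unfolding nontrivial_def intersecting_def
    proof (intro conjI ballI allI)
      fix u v assume "u \<in> F i" "v \<in> F i"
      then have "Suc ` pts (snd u) \<inter> Suc ` pts (snd v) \<noteq> {}"
        using C(1)[OF i] unfolding nontrivial_intersecting_def F_def by blast
      then show "meets (snd u) (snd v)" by (auto simp: meets_iff)
    next
      fix x
      obtain A where A: "A \<in> C i" "Suc x \<notin> A"
        using C(1)[OF i] unfolding nontrivial_intersecting_def by blast
      then have "A \<in> stable_subsets n 3 3" using C(2) i by blast
      then obtain v where "v \<in> ?V" "Suc ` pts (snd v) = A"
        using orbits_complete[OF assms(2,3)] by blast
      then show "\<exists>v\<in>F i. x \<notin> pts (snd v)"
        using A unfolding F_def by blast
    qed
  qed
  then have "sum fst (\<Union>i<n - 7. F i) \<le> int (n - 7) * W"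
    using orbits_stable(2)[OF assms(2)] by (intro sum_cover_le) (simp_all add: F_def)
  moreover have "(\<Union>i<n - 7. F i) = ?V"
    using orbits_stable(1)[OF assms(2)] C(2) unfolding F_def by blast
  moreover have "sum fst ?V = sum_list (map fst (concat (orbits n rs)))"
    using assms(4) by (rule sum.distinct_set_conv_list)
  ultimately have "sum_list (map fst (concat (orbits n rs))) \<le> int (n - 7) * W"
    by (simp only:)
  then show False using assms(5) leD by blast
qed

section \<open>Certificates for small cycles\<close>

lemma covers_gapsI:
  assumes "list_all (\<lambda>g. list_all (\<lambda>h.
    (g, h) \<in> G \<or> (h, n - (g + h)) \<in> G \<or> (n - (g + h), g) \<in> G) [3..<n - g - 2]) [3..<n - 5]"
  shows "covers_gaps n G"
  using assms unfolding covers_gaps_def list_all_iff by auto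

text \<open>Collects the premises that need computation. Kept folded, it shields them from the first
  simplifier call, in which \<open>orbits\<close> is expanded to explicit lists.\<close>

definition certified :: "int \<Rightarrow> int \<Rightarrow> vtx list list \<Rightarrow> bool" where
  "certified k W Us \<longleftrightarrow>
     check W Us \<and> distinct (concat Us) \<and> k * W < sum_list (map fst (concat Us))"

lemma uncoverableI:
  assumes "certified k W (orbits n rs)" "k = int (n - 7)"
    and "valid_orbits n rs" "covers_gaps n ((\<lambda>(k, w, g, h). (g, h)) ` set rs)" "0 < n"
  shows "uncoverable n"
  unfolding uncoverable_def
proof (intro allI impI notI)
  fix C assume "\<forall>i < n - 7. nontrivial_intersecting (C i)" "(\<Union>i<n - 7. C i) = stable_subsets n 3 3"
  then show False
    using certificate[OF _ assms(3,4) _ _ assms(5), of W C] assms(1,2)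
    by (simp only: certified_def) blast
qed

lemmas orbits_eval = orbits_simps rep_def eval_nat_numeral

lemmas certificate_rules = certified_def search_rules distinct.simps list.set list.inject prod.inject
  insert_iff empty_iff list.map fst_conv sum_list.Cons sum_list.Nil

text \<open>The weights and the order of the orbits were found by a random search.\<close>

lemma uncoverable_10: "uncoverable 10"
proof (rule uncoverableI)
  let ?rs = "[(10, 4, 3, 3)]"
  \<comment> \<open>\<open>3\<close> is the number \<open>n - 7\<close> of families and
    \<open>13\<close> the bound for each: \<open>3 * 13 = 39\<close>, while the total weight is
    \<open>10 * 4 = 40\<close>. The next cases follow the same pattern.\<close>
  show "certified 3 13 (orbits 10 ?rs)"
    by (simp add: orbits_eval) (simp only: certificate_rules)
  show "valid_orbits 10 ?rs"
    by (simp add: valid_orbits_def)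
  show "covers_gaps 10 ((\<lambda>(k, w, g, h). (g, h)) ` set ?rs)"
    by (rule covers_gapsI) simp
qed simp_all

lemma uncoverable_11: "uncoverable 11"
proof (rule uncoverableI)
  let ?rs = "[(11, 1, 3, 4), (11, 4, 3, 3)]"
  show "certified 4 13 (orbits 11 ?rs)"
    by (simp add: orbits_eval) (simp only: certificate_rules)
  show "valid_orbits 11 ?rs"
    by (simp add: valid_orbits_def)
  show "covers_gaps 11 ((\<lambda>(k, w, g, h). (g, h)) ` set ?rs)"
    by (rule covers_gapsI) simp
qed simp_all

lemma uncoverable_12: "uncoverable 12"
proof (rule uncoverableI)
  let ?rs = "[(12, 2, 3, 3), (12, 1, 3, 5), (12, 1, 3, 4), (4, 6, 4, 4)]"
  show "certified 5 14 (orbits 12 ?rs)"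
    by (simp add: orbits_eval) (simp only: certificate_rules)
  show "valid_orbits 12 ?rs"
    by (simp add: valid_orbits_def)
  show "covers_gaps 12 ((\<lambda>(k, w, g, h). (g, h)) ` set ?rs)"
    by (rule covers_gapsI) simp
qed simp_all

lemma uncoverable_13: "uncoverable 13"
proof (rule uncoverableI)
  let ?rs = "[(13, 6, 4, 4), (13, 1, 3, 6), (13, 5, 3, 5), (13, 1, 3, 4), (13, 6, 3, 3)]"
  \<comment> \<open>The total weight \<open>13 * 19 = 247\<close> beats \<open>6 * 41 = 246\<close>
    by just one.\<close>
  show "certified 6 41 (orbits 13 ?rs)"
    by (simp add: orbits_eval) (simp only: certificate_rules)
  show "valid_orbits 13 ?rs"
    by (simp add: valid_orbits_def)
  show "covers_gaps 13 ((\<lambda>(k, w, g, h). (g, h)) ` set ?rs)"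
    by (rule covers_gapsI) simp
qed simp_all

lemma uncoverable_14: "uncoverable 14"
proof (rule uncoverableI)
  let ?rs = "[(14, 5, 4, 5), (14, 2, 3, 3), (14, 1, 3, 7), (14, 1, 3, 4), (14, 1, 3, 5),
      (14, 1, 4, 4), (14, 1, 3, 6)]"
  show "certified 7 23 (orbits 14 ?rs)"
    by (simp add: orbits_eval) (simp only: certificate_rules)
  show "valid_orbits 14 ?rs"
    by (simp add: valid_orbits_def)
  show "covers_gaps 14 ((\<lambda>(k, w, g, h). (g, h)) ` set ?rs)"
    by (rule covers_gapsI) simp
qed simp_all

lemma uncoverable_15: "uncoverable 15"
proof (rule uncoverableI)
  let ?rs = "[(15, 5, 4, 6), (15, 3, 3, 4), (15, 3, 3, 8), (15, 2, 4, 4), (15, 2, 3, 6),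
      (15, 1, 3, 7), (15, 3, 3, 3), (15, 5, 4, 5), (5, 5, 5, 5), (15, 1, 3, 5)]"
  show "certified 8 49 (orbits 15 ?rs)"
    by (simp add: orbits_eval) (simp only: certificate_rules)
  show "valid_orbits 15 ?rs"
    by (simp add: valid_orbits_def)
  show "covers_gaps 15 ((\<lambda>(k, w, g, h). (g, h)) ` set ?rs)"
    by (rule covers_gapsI) simp
qed simp_all

lemma uncoverable_16: "uncoverable 16"
proof (rule uncoverableI)
  let ?rs = "[(16, 5, 4, 6), (16, 2, 3, 6), (16, 2, 3, 7), (16, 1, 3, 4), (16, 1, 3, 9),
      (16, 1, 3, 3), (16, 2, 5, 5), (16, 1, 4, 4), (16, 5, 4, 7), (16, 4, 3, 8),
      (16, 4, 3, 5), (16, 5, 4, 5)]"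
  show "certified 9 58 (orbits 16 ?rs)"
    by (simp add: orbits_eval) (simp only: certificate_rules)
  show "valid_orbits 16 ?rs"
    by (simp add: valid_orbits_def)
  show "covers_gaps 16 ((\<lambda>(k, w, g, h). (g, h)) ` set ?rs)"
    by (rule covers_gapsI) simp
qed simp_all

section \<open>Large cycles\<close>

text \<open>By \<open>flag\<close>, \<open>V\<close> consists of all triangles of the graph formed
  by its pairs. For stable triples \<open>D\<close> is \<open>n - 8\<close>, so
  \<open>9 \<le> D\<close> amounts to \<open>17 \<le> n\<close>. A pair is heavy if at least four
  members of \<open>F\<close> contain it.\<close>

locale triple_family =
  fixes V F :: "'a set set" and D :: nat
  assumes finite_V: "finite V"
    and card_V: "A \<in> V \<Longrightarrow> card A = 3"
    and degree: "x \<noteq> y \<Longrightarrow> card {A \<in> V. x \<in> A \<and> y \<in> A} \<le> D"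
    and flag: "\<lbrakk>x \<noteq> y; y \<noteq> z; x \<noteq> z; \<exists>A \<in> V. x \<in> A \<and> y \<in> A; \<exists>A \<in> V. y \<in> A \<and> z \<in> A; \<exists>A \<in> V. x \<in> A \<and> z \<in> A\<rbrakk>
      \<Longrightarrow> {x, y, z} \<in> V"
    and D: "9 \<le> D"
    and F_subset: "F \<subseteq> V"
    and F: "nontrivial_intersecting F"
begin

abbreviation link :: "'a \<Rightarrow> 'a \<Rightarrow> 'a set set" where
  "link x y \<equiv> {A \<in> F. x \<in> A \<and> y \<in> A}"

abbreviation V_link :: "'a \<Rightarrow> 'a \<Rightarrow> 'a set set" where
  "V_link x y \<equiv> {A \<in> V. x \<in> A \<and> y \<in> A}"

lemma finite_F: "finite F"
  using F_subset finite_V finite_subset by blast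

lemma member: "A \<in> F \<Longrightarrow> finite A" "A \<in> F \<Longrightarrow> card A = 3"
  using card_V F_subset card.infinite by (metis subsetD zero_neq_numeral)+

lemma link_le: "x \<noteq> y \<Longrightarrow> card (link x y) \<le> D"
  using F_subset finite_V by (intro order.trans[OF card_mono degree[of x y]]) auto

lemma meet: "A \<in> F \<Longrightarrow> B \<in> F \<Longrightarrow> A \<inter> B \<noteq> {}"
  using F by (simp add: nontrivial_intersecting_def)

lemma avoid: obtains A where "A \<in> F" "x \<notin> A"
  using F unfolding nontrivial_intersecting_def by blast

lemma third_point:
  assumes "A \<in> V" "x \<in> A" "y \<in> A" "x \<noteq> y"
  obtains z where "A = {x, y, z}" "z \<noteq> x" "z \<noteq> y"
proof -
  have "card A = 3" "finite A" using card_V[OF assms(1)] card.infinite by force+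
  then have "card (A - {x, y}) = 1" using assms by (simp add: card_Diff_subset)
  then obtain z where "A - {x, y} = {z}" by (auto simp: card_1_singleton_iff)
  then show thesis using assms by (intro that[of z]) blast+
qed

text \<open>
  A pair contained in four members of \<open>F\<close> meets every member: a set avoiding the pair would have to
  contain the third points of the four members.
\<close>

lemma heavy:
  assumes "x \<noteq> y" "4 \<le> card (link x y)" "B \<in> F"
  shows "x \<in> B \<or> y \<in> B"
proof (rule ccontr)
  assume neg: "\<not> (x \<in> B \<or> y \<in> B)"
  have B: "finite B" "card B = 3" using member assms(3) by blast+
  have "link x y \<subseteq> (\<lambda>z. {x, y, z}) ` B"
  proof
    fix A assume A: "A \<in> link x y"
    then obtain z where z: "A = {x, y, z}"
      using third_point[of A x y] assms(1) F_subset by blast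
    then have "z \<in> B" using meet[of A B] A assms(3) neg by auto
    then show "A \<in> (\<lambda>z. {x, y, z}) ` B" using z by blast
  qed
  then have "card (link x y) \<le> card ((\<lambda>z. {x, y, z}) ` B)"
    using B(1) by (intro card_mono) auto
  also have "\<dots> \<le> 3" using card_image_le[OF B(1)] B(2) by metis
  finally show False using assms(2) by simp
qed

lemma heavy_adjacent:
  assumes "4 \<le> card (link x y)"
  shows "\<exists>A \<in> V. x \<in> A \<and> y \<in> A"
proof -
  have "link x y \<noteq> {}" using assms by (metis card.empty not_numeral_le_zero)
  then show ?thesis using F_subset by blast
qed

text \<open>Sets through a point \<open>a\<close> of a member \<open>A\<close> meet some member
  \<open>B\<close> avoiding \<open>a\<close>, so there are at most \<open>3 * 3\<close> of them,
  hence 8 besides \<open>A\<close>. Every member meets \<open>A\<close>, which gives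
  \<open>1 + 3 * 8\<close>.\<close>

lemma card_no_heavy:
  assumes light: "\<And>x y. x \<noteq> y \<Longrightarrow> card (link x y) \<le> 3"
  shows "card F \<le> 25"
proof -
  obtain A where A: "A \<in> F" using avoid by metis
  then have cA: "finite A" "card A = 3" using member by blast+
  have star: "card ({C \<in> F. a \<in> C} - {A}) \<le> 8" if "a \<in> A" for a
  proof -
    obtain B where B: "B \<in> F" "a \<notin> B" using avoid by blast
    then have cB: "finite B" "card B = 3" using member by blast+
    have "{C \<in> F. a \<in> C} \<subseteq> (\<Union>b\<in>B. link a b)"
      using meet[OF _ B(1)] by blast
    then have "card {C \<in> F. a \<in> C} \<le> card (\<Union>b\<in>B. link a b)"
      using cB finite_F by (intro card_mono) auto
    also have "\<dots> \<le> (\<Sum>b\<in>B. card (link a b))"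
      using cB(1) by (rule card_UN_le)
    also have "\<dots> \<le> (\<Sum>b\<in>B. 3)"
      using B(2) by (intro sum_mono light) auto
    finally have "card {C \<in> F. a \<in> C} \<le> 9" using cB by simp
    then show ?thesis using A that finite_F by simp
  qed
  have "F - {A} \<subseteq> (\<Union>a\<in>A. {C \<in> F. a \<in> C} - {A})"
    using meet[OF _ A] by blast
  then have "card (F - {A}) \<le> card (\<Union>a\<in>A. {C \<in> F. a \<in> C} - {A})"
    using cA finite_F by (intro card_mono) auto
  also have "\<dots> \<le> (\<Sum>a\<in>A. card ({C \<in> F. a \<in> C} - {A}))"
    using cA(1) by (rule card_UN_le)
  also have "\<dots> \<le> (\<Sum>a\<in>A. 8)"
    using star by (intro sum_mono) auto
  finally show ?thesis using cA A finite_F by simp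
qed

text \<open>Every member meets the heavy pair. At most \<open>D\<close> contain both points. Those
  containing only \<open>x\<close> meet a member avoiding \<open>x\<close>, which contains
  \<open>y\<close>, in one of its two other points: at most \<open>2 * 3\<close>; likewise for
  \<open>y\<close>.\<close>

lemma card_one_heavy:
  assumes "x \<noteq> y" "4 \<le> card (link x y)"
    and x: "\<And>v. v \<noteq> x \<Longrightarrow> v \<noteq> y \<Longrightarrow> card (link x v) \<le> 3"
    and y: "\<And>v. v \<noteq> x \<Longrightarrow> v \<noteq> y \<Longrightarrow> card (link y v) \<le> 3"
  shows "card F \<le> D + 12"
proof -
  have one_sided: "card {C \<in> F. p \<in> C \<and> q \<notin> C} \<le> 6"
    if "p \<noteq> q" "4 \<le> card (link p q)" and light: "\<And>v. v \<noteq> p \<Longrightarrow> v \<noteq> q \<Longrightarrow> card (link p v) \<le> 3" for p q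
  proof -
    obtain B where B: "B \<in> F" "p \<notin> B" using avoid by blast
    then have cB: "finite B" "card B = 3" using member by blast+
    have "q \<in> B" using heavy[OF that(1,2) B(1)] B(2) by blast
    have "{C \<in> F. p \<in> C \<and> q \<notin> C} \<subseteq> (\<Union>b\<in>B - {q}. link p b)"
      using meet[OF _ B(1)] by blast
    then have "card {C \<in> F. p \<in> C \<and> q \<notin> C} \<le> card (\<Union>b\<in>B - {q}. link p b)"
      using cB finite_F by (intro card_mono) auto
    also have "\<dots> \<le> (\<Sum>b\<in>B - {q}. card (link p b))"
      using cB(1) by (intro card_UN_le) simp
    also have "\<dots> \<le> (\<Sum>b\<in>B - {q}. 3)"
      using B(2) by (intro sum_mono light) auto
    finally show ?thesis using cB \<open>q \<in> B\<close> by simp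
  qed
  have "F \<subseteq> link x y \<union> ({C \<in> F. x \<in> C \<and> y \<notin> C} \<union> {C \<in> F. y \<in> C \<and> x \<notin> C})"
    using heavy[OF assms(1,2)] by blast
  then have "card F \<le> card (link x y \<union> ({C \<in> F. x \<in> C \<and> y \<notin> C} \<union> {C \<in> F. y \<in> C \<and> x \<notin> C}))"
    using finite_F by (intro card_mono) auto
  also have "\<dots> \<le> card (link x y) + card ({C \<in> F. x \<in> C \<and> y \<notin> C} \<union> {C \<in> F. y \<in> C \<and> x \<notin> C})"
    by (rule card_Un_le)
  also have "\<dots> \<le> card (link x y) + (card {C \<in> F. x \<in> C \<and> y \<notin> C} + card {C \<in> F. y \<in> C \<and> x \<notin> C})"
    using card_Un_le by (intro add_left_mono)
  also have "\<dots> \<le> D + (6 + 6)"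
  proof (intro add_mono link_le one_sided)
    show "4 \<le> card (link y x)" using assms(2) by (simp add: conj_commute)
  qed (use assms in auto)
  finally show ?thesis by simp
qed

text \<open>Each member meets all three heavy pairs, so it contains two of the points. The triple
  \<open>{x, y, v}\<close> belongs to \<open>V\<close> by \<open>flag\<close> and is shared by the
  three links: \<open>1 + 3 * (D - 1)\<close>.\<close>

lemma card_triangle:
  assumes "x \<noteq> y" "x \<noteq> v" "y \<noteq> v"
    and "4 \<le> card (link x y)" "4 \<le> card (link x v)" "4 \<le> card (link y v)"
  shows "card F \<le> 3 * D - 2"
proof -
  let ?T = "{x, y, v}"
  have T: "?T \<in> V" using assms by (intro flag heavy_adjacent) auto
  have less: "card (V_link p q - {?T}) \<le> D - 1" if "p \<noteq> q" "p \<in> ?T" "q \<in> ?T" for p q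
    using degree[OF that(1)] T that(2,3) finite_V by simp
  have "F \<subseteq> {?T} \<union> ((V_link x y - {?T}) \<union> ((V_link x v - {?T}) \<union> (V_link y v - {?T})))"
    using heavy[OF assms(1,4)] heavy[OF assms(2,5)] heavy[OF assms(3,6)] F_subset by blast
  then have "card F \<le> card ({?T} \<union> ((V_link x y - {?T}) \<union> ((V_link x v - {?T}) \<union> (V_link y v - {?T}))))"
    using finite_V by (intro card_mono) auto
  also have "\<dots> \<le> card {?T} + (card (V_link x y - {?T}) + (card (V_link x v - {?T}) + card (V_link y v - {?T})))"
    by (intro order.trans[OF card_Un_le] add_mono order.refl)
  also have "\<dots> \<le> 1 + ((D - 1) + ((D - 1) + (D - 1)))"
    using assms(1-3) by (intro add_mono less) auto
  finally show ?thesis using D by simp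
qed

text \<open>A member avoiding \<open>x\<close> contains \<open>y\<close>, \<open>v\<close> and
  \<open>b\<close>, so it is \<open>B\<close>; the others lie in one of three links at
  \<open>x\<close>. By \<open>flag\<close> these links overlap pairwise, which gives
  \<open>1 + D + (D - 1) + (D - 2)\<close>.\<close>

lemma card_star:
  assumes "x \<notin> B" "B \<in> F" "B = {y, v, b}" "y \<noteq> v" "b \<noteq> y" "b \<noteq> v"
    and "4 \<le> card (link x y)" "4 \<le> card (link x v)" "4 \<le> card (link x b)"
  shows "card F \<le> 3 * D - 2"
proof -
  have x: "x \<noteq> y" "x \<noteq> v" "x \<noteq> b" using assms(1,3) by auto
  have "B \<in> V" using assms(2) F_subset by blast
  then have B: "\<exists>A \<in> V. p \<in> A \<and> q \<in> A" if "p \<in> B" "q \<in> B" for p q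
    using that by blast
  note adj = heavy_adjacent[OF assms(7)] heavy_adjacent[OF assms(8)] heavy_adjacent[OF assms(9)]
  have T: "{x, y, v} \<in> V" "{x, y, b} \<in> V" "{x, v, b} \<in> V"
    by (rule flag[OF x(1) assms(4) x(2) adj(1) B adj(2)]
          flag[OF x(1) assms(5)[symmetric] x(3) adj(1) B adj(3)]
          flag[OF x(2) assms(6)[symmetric] x(3) adj(2) B adj(3)]; simp add: assms(3))+
  have "F \<subseteq> {B} \<union> (V_link x y \<union> ((V_link x v - {{x, y, v}}) \<union> (V_link x b - {{x, y, b}, {x, v, b}})))"
  proof
    fix C assume C: "C \<in> F"
    show "C \<in> {B} \<union> (V_link x y \<union> ((V_link x v - {{x, y, v}}) \<union> (V_link x b - {{x, y, b}, {x, v, b}})))"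
    proof (cases "x \<in> C")
      case True
      have "y \<in> C \<or> v \<in> C \<or> b \<in> C" using meet[OF C assms(2)] assms(3) by blast
      then show ?thesis using True C F_subset x assms(3-6) by blast
    next
      case False
      then have "y \<in> C" "v \<in> C" "b \<in> C"
        using heavy[OF x(1) assms(7) C] heavy[OF x(2) assms(8) C] heavy[OF x(3) assms(9) C] by auto
      then have "B \<subseteq> C" using assms(3) by blast
      moreover have "card B = 3" "card C = 3" "finite C"
        using member C assms(2) by blast+
      ultimately have "B = C" by (metis card_subset_eq)
      then show ?thesis by blast
    qed
  qed
  then have "card F \<le> card ({B} \<union> (V_link x y \<union> ((V_link x v - {{x, y, v}}) \<union> (V_link x b - {{x, y, b}, {x, v, b}}))))"
    using finite_V by (intro card_mono) auto
  also have "\<dots> \<le> card {B} + (card (V_link x y) + (card (V_link x v - {{x, y, v}}) + card (V_link x b - {{x, y, b}, {x, v, b}})))"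
    by (intro order.trans[OF card_Un_le] add_mono order.refl)
  also have "\<dots> \<le> 1 + (D + ((D - 1) + (D - 2)))"
  proof (intro add_mono degree x)
    show "card (V_link x v - {{x, y, v}}) \<le> D - 1"
      using degree[OF x(2)] T finite_V by simp
    have "y \<notin> {x, v, b}" using assms(4,5) x by auto
    then have "{x, y, b} \<noteq> {x, v, b}" by auto
    then have "card {{x, y, b}, {x, v, b}} = 2" by simp
    moreover have "{{x, y, b}, {x, v, b}} \<subseteq> V_link x b" using T by blast
    ultimately show "card (V_link x b - {{x, y, b}, {x, v, b}}) \<le> D - 2"
      using degree[OF x(3)] finite_V by (simp add: card_Diff_subset)
  qed simp
  finally show ?thesis using D by simp
qed

text \<open>Members avoiding \<open>x\<close> contain \<open>y\<close> and \<open>v\<close>. If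
  neither \<open>y\<close>, \<open>v\<close> nor \<open>x\<close>, \<open>b\<close> is heavy, the
  two heavy links and these two light ones cover \<open>F\<close>, and \<open>2 * D + 6\<close> is
  small enough.\<close>

lemma card_two_heavy:
  assumes xyv: "x \<noteq> y" "x \<noteq> v" "y \<noteq> v"
    and "4 \<le> card (link x y)" "4 \<le> card (link x v)"
  shows "card F \<le> 3 * D - 2"
proof (cases "4 \<le> card (link y v)")
  case True
  then show ?thesis using card_triangle assms by blast
next
  case False
  obtain B where B: "B \<in> F" "x \<notin> B" using avoid by blast
  have both: "y \<in> C \<and> v \<in> C" if "C \<in> F" "x \<notin> C" for C
    using heavy[OF xyv(1) assms(4) that(1)] heavy[OF xyv(2) assms(5) that(1)] that(2) by blast
  obtain b where b: "B = {y, v, b}" "b \<noteq> y" "b \<noteq> v"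
    using third_point[of B y v] both[OF B] B(1) xyv(3) F_subset by blast
  show ?thesis
  proof (cases "4 \<le> card (link x b)")
    case True
    then show ?thesis using card_star[OF B(2,1) b(1) xyv(3) b(2,3)] assms by blast
  next
    case light: False
    have "F \<subseteq> (link y v \<union> link x b) \<union> (link x y \<union> link x v)"
    proof
      fix C assume C: "C \<in> F"
      show "C \<in> (link y v \<union> link x b) \<union> (link x y \<union> link x v)"
        using C both[OF C] meet[OF C B(1)] b(1) by blast
    qed
    then have "card F \<le> card ((link y v \<union> link x b) \<union> (link x y \<union> link x v))"
      using finite_F by (intro card_mono) auto
    also have "\<dots> \<le> (card (link y v) + card (link x b)) + (card (link x y) + card (link x v))"
      by (intro order.trans[OF card_Un_le] add_mono card_Un_le)
    also have "\<dots> \<le> (3 + 3) + (D + D)"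
      using False light xyv by (intro add_mono link_le) auto
    finally show ?thesis using D by simp
  qed
qed

text \<open>The case without heavy pairs is the tightest for \<open>D\<close>:
  \<open>25 \<le> 3 * D - 2\<close> is exactly \<open>9 \<le> D\<close>.\<close>

theorem card_le: "card F \<le> 3 * D - 2"
proof (cases "\<exists>x y. x \<noteq> y \<and> 4 \<le> card (link x y)")
  case False
  then have "card F \<le> 25" by (intro card_no_heavy) force
  then show ?thesis using D by simp
next
  case True
  then obtain x y where xy: "x \<noteq> y" "4 \<le> card (link x y)" by blast
  then have yx: "4 \<le> card (link y x)" by (simp add: conj_commute)
  consider v where "v \<noteq> x" "v \<noteq> y" "4 \<le> card (link x v)"
    | v where "v \<noteq> x" "v \<noteq> y" "4 \<le> card (link y v)"
    | "\<And>v. v \<noteq> x \<Longrightarrow> v \<noteq> y \<Longrightarrow> card (link x v) \<le> 3 \<and> card (link y v) \<le> 3"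
    by force
  then show ?thesis
  proof cases
    case 1
    then show ?thesis using card_two_heavy[of x y v] xy by blast
  next
    case 2
    then show ?thesis using card_two_heavy[of y x v] xy yx by blast
  next
    case 3
    then have "card F \<le> D + 12" using card_one_heavy[OF xy] by blast
    then show ?thesis using D by simp
  qed
qed

end

section \<open>Pair degrees and the number of stable triples\<close>

lemma stable_pair_bounds:
  assumes "A \<in> stable_subsets n 3 3" "x \<in> A" "y \<in> A" "x < y"
  shows "1 \<le> x" "x + 3 \<le> y" "y \<le> n" "y + 3 \<le> x + n"
proof -
  have "x \<in> {1..n}" "y \<in> {1..n}" "3 \<le> cyc_dist n x y"
    using assms by (auto simp: stable_subsets_def stable_def)
  then show "1 \<le> x" "x + 3 \<le> y" "y \<le> n" "y + 3 \<le> x + n"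
    using assms(4) by (auto simp: cyc_dist_def)
qed

lemma stable_flag:
  assumes "x \<noteq> y" "y \<noteq> z" "x \<noteq> z"
    and "\<exists>A \<in> stable_subsets n 3 3. x \<in> A \<and> y \<in> A" "\<exists>A \<in> stable_subsets n 3 3. y \<in> A \<and> z \<in> A"
      "\<exists>A \<in> stable_subsets n 3 3. x \<in> A \<and> z \<in> A"
  shows "{x, y, z} \<in> stable_subsets n 3 3"
proof -
  have far: "p \<in> {1..n} \<and> 3 \<le> cyc_dist n p q \<and> 3 \<le> cyc_dist n q p"
    if "\<exists>A \<in> stable_subsets n 3 3. p \<in> A \<and> q \<in> A" "p \<noteq> q" for p q
    using that unfolding stable_subsets_def stable_def by fast
  have "z \<in> {1..n}"
    using assms(5) unfolding stable_subsets_def by blast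
  then show ?thesis
    using far[OF assms(4,1)] far[OF assms(5,2)] far[OF assms(6,3)] assms(1-3)
    by (simp add: stable_subsets_def stable_def)
qed

text \<open>The third point lies in one of the two arcs, three steps away from both ends. The worst
  case is a gap of 3: the short arc has no room and the other one \<open>n - 3 - 5\<close>
  positions.\<close>

lemma stable_pair_degree_aux:
  assumes "x < y"
  shows "card {A \<in> stable_subsets n 3 3. x \<in> A \<and> y \<in> A} \<le> n - 8"
proof (cases "x + 3 \<le> y \<and> y + 3 \<le> x + n \<and> y \<le> n")
  case False
  then have "{A \<in> stable_subsets n 3 3. x \<in> A \<and> y \<in> A} = {}"
    using stable_pair_bounds assms by blast
  then show ?thesis by (simp only: card.empty)
next
  case xy: True
  let ?N = "{x + 3..y - 3} \<union> {y + 3..x + n - 3}"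
  \<comment> \<open>Positions on the outer arc are numbered past \<open>n\<close> and reduced
    here.\<close>
  let ?h = "\<lambda>m. {x, y, if m \<le> n then m else m - n}"
  have "{A \<in> stable_subsets n 3 3. x \<in> A \<and> y \<in> A} \<subseteq> ?h ` ?N"
  proof
    fix A assume "A \<in> {A \<in> stable_subsets n 3 3. x \<in> A \<and> y \<in> A}"
    then have A: "A \<in> stable_subsets n 3 3" "x \<in> A" "y \<in> A" by auto
    then obtain a b c where "A = {a, b, c}" "a < b" "b < c"
      unfolding stable_subsets_3_3_iff by force
    then obtain z where z: "A = {x, y, z}" "z \<noteq> x" "z \<noteq> y"
      using A(2,3) assms by (metis insertE insert_commute less_irrefl_nat less_trans singletonD)
    define m where "m = (if z < x then z + n else z)"
    have "z \<in> A" using z by simp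
    have "1 \<le> z" "z \<le> n" using A(1) \<open>z \<in> A\<close> by (auto simp: stable_subsets_def)
    consider "z < x" | "x < z" "z < y" | "y < z" using z(2,3) by linarith
    then have "m \<in> ?N"
    proof cases
      case 1
      then show ?thesis
        using stable_pair_bounds[OF A(1) \<open>z \<in> A\<close> A(3)] stable_pair_bounds[OF A(1) \<open>z \<in> A\<close> A(2)] xy
        by (simp add: m_def) linarith
    next
      case 2
      then show ?thesis
        using stable_pair_bounds[OF A(1,2) \<open>z \<in> A\<close>] stable_pair_bounds[OF A(1) \<open>z \<in> A\<close> A(3)] xy
        by (auto simp: m_def)
    next
      case 3
      then show ?thesis
        using stable_pair_bounds[OF A(1,2) \<open>z \<in> A\<close>] stable_pair_bounds[OF A(1,3) \<open>z \<in> A\<close>] xy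
        by (auto simp: m_def)
    qed
    moreover have "?h m = A"
      using z \<open>1 \<le> z\<close> \<open>z \<le> n\<close> by (auto simp: m_def)
    ultimately show "A \<in> ?h ` ?N" by blast
  qed
  then have "card {A \<in> stable_subsets n 3 3. x \<in> A \<and> y \<in> A} \<le> card (?h ` ?N)"
    by (intro card_mono) auto
  also have "\<dots> \<le> card ?N" by (intro card_image_le) auto
  also have "\<dots> \<le> card {x + 3..y - 3} + card {y + 3..x + n - 3}" by (rule card_Un_le)
  also have "\<dots> \<le> n - 8" using xy by auto
  finally show ?thesis .
qed

lemma stable_pair_degree:
  assumes "x \<noteq> y"
  shows "card {A \<in> stable_subsets n 3 3. x \<in> A \<and> y \<in> A} \<le> n - 8"
  using stable_pair_degree_aux[of x y n] stable_pair_degree_aux[of y x n] assms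
  by (cases x y rule: linorder_cases) (simp_all add: conj_commute)

lemma card_nontrivial_intersecting:
  assumes "17 \<le> n" "F \<subseteq> stable_subsets n 3 3" "nontrivial_intersecting F"
  shows "card F \<le> 3 * (n - 8) - 2"
proof -
  interpret triple_family "stable_subsets n 3 3" F "n - 8"
  proof
    show "finite (stable_subsets n 3 3)" by (rule finite_stable_subsets)
    show "card A = 3" if "A \<in> stable_subsets n 3 3" for A
      using that by (simp add: stable_subsets_def)
    show "9 \<le> n - 8" using assms(1) by simp
  qed (use assms stable_pair_degree stable_flag in blast)+
  show ?thesis by (rule card_le)
qed

text \<open>Triples with a marked point are counted: a start \<open>s\<close> and offsets
  \<open>g\<close>, \<open>e\<close> of the other two points determine one, injectively, and each
  triple has three marked versions.\<close>

lemma card_stable_subsets_ge: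
  assumes "9 \<le> n"
  shows "n * (n - 7) * (n - 8) \<le> 6 * card (stable_subsets n 3 3)"
proof -
  let ?G = "SIGMA g:{3..n - 6}. {g + 3..n - 3}"
  let ?P = "SIGMA A:stable_subsets n 3 3. A"
  let ?f = "\<lambda>(s, g, e). (Suc ` {s, (s + g) mod n, (s + e) mod n}, Suc s)"
  have le: "card ({..<n} \<times> ?G) \<le> card ?P"
  proof (rule card_inj_on_le[of ?f])
    show "?f ` ({..<n} \<times> ?G) \<subseteq> ?P"
    proof (rule image_subsetI)
      fix t assume "t \<in> {..<n} \<times> ?G"
      then obtain s g e where t: "t = (s, g, e)" "s < n" "3 \<le> g" "g + 3 \<le> e" "e + 3 \<le> n"
        using assms by auto
      then have "Suc ` {s, (s + g) mod n, (s + (g + (e - g))) mod n} \<in> stable_subsets n 3 3"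
        by (intro triple_stable) auto
      moreover have "g + (e - g) = e" using t by simp
      ultimately show "?f t \<in> ?P" using t(1) by simp
    qed
    show "finite ?P"
    proof (rule finite_SigmaI[OF finite_stable_subsets])
      fix A assume "A \<in> stable_subsets n 3 3"
      then show "finite A" using finite_subset by (auto simp: stable_subsets_def)
    qed
    show "inj_on ?f ({..<n} \<times> ?G)"
    proof (rule inj_onI)
      fix t t' assume *: "t \<in> {..<n} \<times> ?G" "t' \<in> {..<n} \<times> ?G" "?f t = ?f t'"
      obtain s g e s' g' e' where t: "t = (s, g, e)" "t' = (s', g', e')"
        by (cases t, cases t')
      have r: "s \<in> {..<n}" "g \<in> {3..n - 6}" "e \<in> {g + 3..n - 3}"
          "g' \<in> {3..n - 6}" "e' \<in> {g' + 3..n - 3}"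
        using *(1,2) unfolding t by auto
      have eq: "Suc ` {s, (s + g) mod n, (s + e) mod n} = Suc ` {s', (s' + g') mod n, (s' + e') mod n}"
          "Suc s = Suc s'"
        using *(3) unfolding t by (simp_all only: prod.case prod.inject)
      \<comment> \<open>Rotating back by \<open>s\<close> turns the positions into the offsets
        \<open>0\<close>, \<open>g\<close>, \<open>e\<close>, which their order then
        identifies.\<close>
      have unshift: "(n - s + (s + x) mod n) mod n = x" if "x < n" for x
        using mod_eq_iff[of s n "(s + x) mod n" x] r(1) that by simp
      have image: "(\<lambda>i. (n - s + i) mod n) ` {s, (s + g) mod n, (s + e) mod n} = {0, g, e}"
        if "g < n" "e < n" for g e
        using unshift[of 0] unshift[OF that(1)] unshift[OF that(2)] r(1) by simp
      have "{s, (s + g) mod n, (s + e) mod n} = {s, (s + g') mod n, (s + e') mod n}"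
        using eq(2) inj_image_eq_iff[THEN iffD1, OF inj_Suc eq(1)] by simp
      moreover have lt: "g < n" "e < n" "g' < n" "e' < n" using r assms by auto
      ultimately have "{0, g, e} = {0, g', e'}"
        using image[OF lt(1,2)] image[OF lt(3,4)] by simp
      then have "g \<in> {0, g', e'}" "e \<in> {0, g', e'}" "g' \<in> {0, g, e}" "e' \<in> {0, g, e}"
        by blast+
      then have "g = g' \<and> e = e'"
        using r by auto
      then show "t = t'" using eq(2) t by simp
    qed
  qed
  have P: "card ?P = 3 * card (stable_subsets n 3 3)"
  proof -
    have "card ?P = (\<Sum>A\<in>stable_subsets n 3 3. card A)"
      using finite_subset by (intro card_SigmaI finite_stable_subsets) (auto simp: stable_subsets_def)
    also have "\<dots> = (\<Sum>A\<in>stable_subsets n 3 3. 3)"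
      by (intro sum.cong) (auto simp: stable_subsets_def)
    finally show ?thesis by simp
  qed
  have G: "2 * card ?G = (n - 7) * (n - 8)"
  proof -
    define m where "m = n - 8"
    then have m: "n = m + 8" using assms by simp
    have "card ?G = (\<Sum>g\<in>{3..n - 6}. n - 5 - g)"
      by (subst card_SigmaI) (auto intro!: sum.cong)
    \<comment> \<open>\<open>g\<close> leaves \<open>m + 3 - g\<close> choices for \<open>e\<close>,
      running from \<open>m\<close> down to 1.\<close>
    also have "\<dots> = (\<Sum>j\<in>{1..m}. j)"
      by (rule sum.reindex_bij_witness[of _ "\<lambda>j. m + 3 - j" "\<lambda>g. m + 3 - g"]) (auto simp: m)
    finally show ?thesis using gauss_sum_from_Suc_0[of m, where 'a = nat] by (simp add: m)
  qed
  have "n * (n - 7) * (n - 8) = 2 * (n * card ?G)"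
    by (simp only: mult.assoc mult.left_commute[of 2] G)
  also have "\<dots> = 2 * card ({..<n} \<times> ?G)"
    by (simp only: card_cartesian_product card_lessThan)
  finally show ?thesis using le P by linarith
qed

lemma uncoverable_large:
  assumes "17 \<le> n"
  shows "uncoverable n"
  unfolding uncoverable_def
proof (intro allI impI notI)
  fix C assume C: "\<forall>i<n - 7. nontrivial_intersecting (C i)" "(\<Union>i<n - 7. C i) = stable_subsets n 3 3"
  have "card (C i) \<le> 3 * (n - 8) - 2" if "i \<in> {..<n - 7}" for i
    using C that by (intro card_nontrivial_intersecting assms) auto
  then have "(\<Sum>i<n - 7. card (C i)) \<le> (n - 7) * (3 * (n - 8) - 2)"
    using sum_bounded_above[of "{..<n - 7}" "\<lambda>i. card (C i)"] by simp
  moreover have "card (stable_subsets n 3 3) \<le> (\<Sum>i<n - 7. card (C i))"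
    using card_UN_le[of "{..<n - 7}" C] C(2) by simp
  ultimately have "n * (n - 7) * (n - 8) \<le> 6 * ((n - 7) * (3 * (n - 8) - 2))"
    using card_stable_subsets_ge[of n] assms by linarith
  \<comment> \<open>Dividing by \<open>n - 7\<close> leaves
    \<open>n * (n - 8) \<le> 18 * (n - 8) - 12\<close>, false from 17 on; at 17 it reads
    \<open>153 \<le> 150\<close>, so the \<open>- 2\<close> in the bound is decisive.\<close>
  moreover define m where "m = n - 17"
  then have "n = m + 17" using assms by simp
  ultimately show False by (simp add: algebra_simps)
qed

section \<open>The chromatic number\<close>

definition colorable :: "nat \<Rightarrow> nat \<Rightarrow> bool" where
  "colorable n c \<longleftrightarrow> (\<exists>f. (\<forall>A \<in> stable_subsets n 3 3. f A < c) \<and>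
     (\<forall>A \<in> stable_subsets n 3 3. \<forall>B \<in> stable_subsets n 3 3. A \<inter> B = {} \<longrightarrow> f A \<noteq> f B))"

definition skip :: "nat \<Rightarrow> nat \<Rightarrow> nat" where
  "skip x j = (if j < x then j else Suc j)"

lemma inj_skip: "inj (skip x)"
  by (auto simp: inj_def skip_def split: if_splits)

text \<open>Inserting the point \<open>x\<close> into the cycle can only widen gaps.\<close>

lemma skip_image_stable:
  assumes "A \<in> stable_subsets n 3 3"
  shows "skip x ` A \<in> stable_subsets (Suc n) 3 3" "x \<notin> skip x ` A"
proof -
  obtain a b c where abc: "A = {a, b, c}" "1 \<le> a" "a + 3 \<le> b" "b + 3 \<le> c" "c \<le> n" "c + 3 \<le> a + n"
    using assms unfolding stable_subsets_3_3_iff by blast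
  show "skip x ` A \<in> stable_subsets (Suc n) 3 3"
    unfolding stable_subsets_3_3_iff
  proof (intro exI conjI)
    show "skip x ` A = {skip x a, skip x b, skip x c}" by (simp add: abc(1))
  qed (use abc in \<open>auto simp: skip_def\<close>)
  show "x \<notin> skip x ` A"
    by (auto simp: skip_def)
qed

text \<open>Embedded triples avoid \<open>x\<close> and so never get colour \<open>i\<close>; the
  freed colour \<open>i\<close> replaces the top colour \<open>c\<close>.\<close>

lemma colorable_remove_star:
  assumes f: "\<forall>A \<in> stable_subsets (Suc n) 3 3. f A \<le> c"
      "\<forall>A \<in> stable_subsets (Suc n) 3 3. \<forall>B \<in> stable_subsets (Suc n) 3 3. A \<inter> B = {} \<longrightarrow> f A \<noteq> f B"
    and i: "i \<le> c" "\<forall>A \<in> stable_subsets (Suc n) 3 3. f A = i \<longrightarrow> x \<in> A"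
  shows "colorable n c"
proof -
  let ?g = "\<lambda>A. let k = f (skip x ` A) in if k = c then i else k"
  have ne: "f (skip x ` A) \<noteq> i" if "A \<in> stable_subsets n 3 3" for A
    using i(2) skip_image_stable[OF that, of x] by blast
  show ?thesis
    unfolding colorable_def
  proof (intro exI[of _ ?g] conjI ballI impI)
    fix A assume A: "A \<in> stable_subsets n 3 3"
    then have "f (skip x ` A) \<le> c" using f(1) skip_image_stable(1) by blast
    then show "?g A < c" using ne[OF A] i(1) by (auto simp: Let_def)
  next
    fix A B assume AB: "A \<in> stable_subsets n 3 3" "B \<in> stable_subsets n 3 3" "A \<inter> B = {}"
    then have "skip x ` A \<inter> skip x ` B = {}"
      by (simp flip: image_Int[OF inj_skip])
    then have "f (skip x ` A) \<noteq> f (skip x ` B)"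
      using f(2)[rule_format, OF skip_image_stable(1)[OF AB(1)] skip_image_stable(1)[OF AB(2)]] by simp
    then show "?g A \<noteq> ?g B"
      using ne[OF AB(1)] ne[OF AB(2)] by (auto simp: Let_def)
  qed
qed

lemma uncoverable_ge_10:
  assumes "10 \<le> n"
  shows "uncoverable n"
proof -
  consider "n = 10" | "n = 11" | "n = 12" | "n = 13" | "n = 14" | "n = 15" | "n = 16" | "17 \<le> n"
    using assms by linarith
  then show ?thesis
    using uncoverable_10 uncoverable_11 uncoverable_12 uncoverable_13 uncoverable_14
      uncoverable_15 uncoverable_16 uncoverable_large by cases simp_all
qed

lemma colorable_lower_bound:
  assumes "9 \<le> n" "colorable n c"
  shows "n - 6 \<le> c"
  using assms
proof (induction n arbitrary: c rule: nat_induct_at_least)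
  case base
  then obtain f where f: "\<forall>A \<in> stable_subsets 9 3 3. f A < c"
      "\<forall>A \<in> stable_subsets 9 3 3. \<forall>B \<in> stable_subsets 9 3 3. A \<inter> B = {} \<longrightarrow> f A \<noteq> f B"
    unfolding colorable_def by blast
  \<comment> \<open>The residue classes modulo 3 are pairwise disjoint and force three
    colours.\<close>
  have V: "{1, 4, 7} \<in> stable_subsets 9 3 3" "{2, 5, 8} \<in> stable_subsets 9 3 3" "{3, 6, 9} \<in> stable_subsets 9 3 3"
    by (auto simp: stable_subsets_def stable_def cyc_dist_def)
  then have "f {1, 4, 7} \<noteq> f {2, 5, 8}" "f {1, 4, 7} \<noteq> f {3, 6, 9}" "f {2, 5, 8} \<noteq> f {3, 6, 9}"
    by (intro f(2)[rule_format]; simp)+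
  moreover have "f {1, 4, 7} < c" "f {2, 5, 8} < c" "f {3, 6, 9} < c"
    using V f(1) by blast+
  ultimately show ?case by linarith
next
  case (Suc n)
  from Suc.prems obtain f where f: "\<forall>A \<in> stable_subsets (Suc n) 3 3. f A < c"
      "\<forall>A \<in> stable_subsets (Suc n) 3 3. \<forall>B \<in> stable_subsets (Suc n) 3 3. A \<inter> B = {} \<longrightarrow> f A \<noteq> f B"
    unfolding colorable_def by blast
  show ?case
  proof (rule ccontr)
    assume "\<not> Suc n - 6 \<le> c"
    then have c: "c \<le> Suc n - 7" by simp
    \<comment> \<open>Indices from \<open>c\<close> on give empty classes, which have every point in
      common and thus count as stars.\<close>
    define C where "C i = {A \<in> stable_subsets (Suc n) 3 3. f A = i}" for i
    have "(\<Union>i<Suc n - 7. C i) = stable_subsets (Suc n) 3 3"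
      using f(1) c by (fastforce simp: C_def)
    moreover have "uncoverable (Suc n)" using Suc.hyps by (intro uncoverable_ge_10) simp
    ultimately obtain i where i: "i < Suc n - 7" "\<not> nontrivial_intersecting (C i)"
      unfolding uncoverable_def by blast
    then obtain x where x: "\<forall>A \<in> C i. x \<in> A"
      using f(2) unfolding nontrivial_intersecting_def C_def by blast
    have "colorable n (n - 7)"
    proof (rule colorable_remove_star[OF _ f(2)])
      show "\<forall>A \<in> stable_subsets (Suc n) 3 3. f A \<le> n - 7"
        using f(1) c Suc.hyps by fastforce
      show "i \<le> n - 7" using i(1) by simp
      show "\<forall>A \<in> stable_subsets (Suc n) 3 3. f A = i \<longrightarrow> x \<in> A"
        using x by (simp add: C_def)
    qed
    then have "n - 6 \<le> n - 7" by (rule Suc.IH)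
    then show False using Suc.hyps by simp
  qed
qed

lemma proper_coloring_iff:
  "(\<exists>f. proper_coloring (stable_kneser_graph n 3 3) c f) \<longleftrightarrow> colorable n c"
proof -
  have ne: "A \<noteq> B" if "A \<in> stable_subsets n 3 3" "A \<inter> B = {}" for A B
    using that by (auto simp: stable_subsets_def)
  have "proper_coloring (stable_kneser_graph n 3 3) c f \<longleftrightarrow> (\<forall>A \<in> stable_subsets n 3 3. f A < c) \<and>
     (\<forall>A \<in> stable_subsets n 3 3. \<forall>B \<in> stable_subsets n 3 3. A \<inter> B = {} \<longrightarrow> f A \<noteq> f B)" for f
    unfolding proper_coloring_def stable_kneser_graph_def using ne
    by (simp add: image_subset_iff) blast
  then show ?thesis unfolding colorable_def by simp
qed

text \<open>Triples with equal minimum intersect, and two further points at gaps of at least 3 keep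
  the minimum at most \<open>n - 6\<close>. Subtracting 1 makes the colours start at 0.\<close>

lemma colorable_min: "colorable n (n - 6)"
  unfolding colorable_def
proof (intro exI[of _ "\<lambda>A. Min A - 1"] conjI ballI impI)
  fix A assume "A \<in> stable_subsets n 3 3"
  then obtain a b c where "A = {a, b, c}" "1 \<le> a" "a + 3 \<le> b" "b + 3 \<le> c" "c \<le> n"
    unfolding stable_subsets_3_3_iff by blast
  then show "Min A - 1 < n - 6" by simp
next
  have Min: "Min A \<in> A" "1 \<le> Min A" if "A \<in> stable_subsets n 3 3" for A
  proof -
    have A: "finite A" "A \<noteq> {}" "A \<subseteq> {1..n}"
      using that finite_subset by (auto simp: stable_subsets_def)
    then show "Min A \<in> A" by (intro Min_in)
    then show "1 \<le> Min A" using A(3) by auto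
  qed
  fix A B assume AB: "A \<in> stable_subsets n 3 3" "B \<in> stable_subsets n 3 3" "A \<inter> B = {}"
  have "Min A \<noteq> Min B" using Min(1)[OF AB(1)] Min(1)[OF AB(2)] AB(3) by (metis disjoint_iff)
  then show "Min A - 1 \<noteq> Min B - 1" using Min(2)[OF AB(1)] Min(2)[OF AB(2)] by simp
qed

theorem theorem1p6:
  fixes n :: nat
  assumes "n \<ge> 9"
  shows "chromatic_number (stable_kneser_graph n 3 3) = n - 6"
  unfolding chromatic_number_def proper_coloring_iff
  by (rule Least_equality) (use assms colorable_min colorable_lower_bound in auto)

end
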